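(* Let $a,b>0$ and let $\Omega_{a,b}=[0,a]\times[0,b]\subset\mathbb{R}^2$. The rectangle $\Omega_{a,b}$ satisfies property (M) if and only if $(a/b)^2$ is rational.
   Context: A planar domain is said to satisfy property (M) if the set of multiplicities of the eigenvalues of the Laplace operator on it with Dirichlet boundary condition (i.e. $-\Delta V=\lambda V$ in the domain, $V=0$ on the boundary) is exactly $\mathbb{N}=\{1,2,3,\dots\}$. The multiplicity of an eigenvalue is the dimension of its eigenspace. *)

theory Defs
  imports "HOL-Analysis.Analysis" "HOL-Library.Function_Algebras"
begin

definition partial_x :: "(real \<times> real \<Rightarrow> real) \<Rightarrow> real \<times> real \<Rightarrow> real" where
  "partial_x u = (\<lambda>(x, y). deriv (\<lambda>s. u (s, y)) x)"

definition partial_y :: "(real \<times> real \<Rightarrow> real) \<Rightarrow> real \<times> real \<Rightarrow> real" where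
  "partial_y u = (\<lambda>(x, y). deriv (\<lambda>t. u (x, t)) y)"

text \<open>\<^const>\<open>deriv\<close> is an unspecified value where the derivative does not exist, so the
  existence of the partial derivatives is required separately. Both predicates below are meant for
  open sets.\<close>

definition C1_on :: "(real \<times> real) set \<Rightarrow> (real \<times> real \<Rightarrow> real) \<Rightarrow> bool" where
  "C1_on U u \<longleftrightarrow>
     (\<forall>(x, y) \<in> U. (\<lambda>s. u (s, y)) differentiable at x \<and> (\<lambda>t. u (x, t)) differentiable at y) \<and>
     continuous_on U (partial_x u) \<and> continuous_on U (partial_y u)"

definition C2_on :: "(real \<times> real) set \<Rightarrow> (real \<times> real \<Rightarrow> real) \<Rightarrow> bool" where
  "C2_on U u \<longleftrightarrow> C1_on U u \<and> C1_on U (partial_x u) \<and> C1_on U (partial_y u)"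

definition laplacian :: "(real \<times> real \<Rightarrow> real) \<Rightarrow> real \<times> real \<Rightarrow> real" where
  "laplacian u p = partial_x (partial_x u) p + partial_y (partial_y u) p"

text \<open>Classical Dirichlet eigenfunctions, together with the zero function. A function on the closure
  of the domain is represented by its extension by zero to the whole plane, so that distinct
  elements of the eigenspace differ on the domain.\<close>

definition dirichlet_eigenspace :: "(real \<times> real) set \<Rightarrow> real \<Rightarrow> (real \<times> real \<Rightarrow> real) set" where
  "dirichlet_eigenspace \<Omega> \<mu> =
     {V. continuous_on (closure \<Omega>) V \<and> C2_on (interior \<Omega>) V \<and>
         (\<forall>p \<in> interior \<Omega>. - laplacian V p = \<mu> * V p) \<and>
         (\<forall>p \<in> frontier \<Omega>. V p = 0) \<and>
         (\<forall>p. p \<notin> closure \<Omega> \<longrightarrow> V p = 0)}"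

definition dirichlet_eigenvalue :: "(real \<times> real) set \<Rightarrow> real \<Rightarrow> bool" where
  "dirichlet_eigenvalue \<Omega> \<mu> \<longleftrightarrow> (\<exists>V \<in> dirichlet_eigenspace \<Omega> \<mu>. \<exists>p. V p \<noteq> 0)"

definition fun_scale :: "real \<Rightarrow> ('a \<Rightarrow> real) \<Rightarrow> 'a \<Rightarrow> real" where
  "fun_scale c f = (\<lambda>x. c * f x)"

lemma vector_space_fun_scale: "vector_space fun_scale"
  by unfold_locales (simp_all add: fun_scale_def fun_eq_iff algebra_simps)

text \<open>The dimension is 0 for infinite-dimensional spaces; since 0 is not a positive integer, an
  eigenvalue of infinite multiplicity would violate property (M), as it should.\<close>

definition eigenvalue_multiplicity :: "(real \<times> real) set \<Rightarrow> real \<Rightarrow> nat" where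
  "eigenvalue_multiplicity \<Omega> \<mu> = vector_space.dim fun_scale (dirichlet_eigenspace \<Omega> \<mu>)"

definition property_M :: "(real \<times> real) set \<Rightarrow> bool" where
  "property_M \<Omega> \<longleftrightarrow> {eigenvalue_multiplicity \<Omega> \<mu> | \<mu>. dirichlet_eigenvalue \<Omega> \<mu>} = {1..}"

end

theory Submission
  imports Defs "HOL-Number_Theory.Cong"
begin

text \<open>The functions \<open>sin (m \<pi> x / a) sin (n \<pi> y / b)\<close> form a complete orthogonal system, and
  Green's identity shows that an eigenfunction for \<open>\<mu>\<close> is orthogonal to all of them except those
  with \<open>(m \<pi> / a)\<^sup>2 + (n \<pi> / b)\<^sup>2 = \<mu>\<close>. So the multiplicity of \<open>\<mu>\<close> is the number of such pairs
  \<open>(m, n)\<close> of positive integers. It is at most 1 if \<open>(a / b)\<^sup>2\<close> is irrational; if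
  \<open>(a / b)\<^sup>2 = p / q\<close>, it is the number of positive solutions of \<open>q m\<^sup>2 + p n\<^sup>2 = N\<close> for a rescaled
  \<open>N\<close>.

  For \<open>q < p\<close> and a suitable prime \<open>l\<close>, let \<open>f j\<close> be the number of positive solutions of
  \<open>q m\<^sup>2 + p n\<^sup>2 = q l\<^bsup>2j\<^esup>\<close>. Multiplication by \<open>l\<close> embeds the solutions for \<open>j\<close> into those for
  \<open>j + 1\<close>, and at most one solution is not in the image, namely a primitive one. Hence \<open>f\<close> starts
  at 0 and grows by steps of at most 1. It is unbounded since the pigeonhole principle (finiteness
  of the class number in disguise) yields primitive solutions of \<open>X\<^sup>2 + p q Y\<^sup>2 = l\<^bsup>2t\<^esup>\<close> for
  arbitrarily large \<open>t\<close>. So \<open>f\<close> attains every value. The case \<open>p = q\<close> of sums of two squares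
  reduces to the form \<open>m\<^sup>2 + 4 n\<^sup>2\<close>.\<close>

section \<open>Prime powers of the form \<open>X\<^sup>2 + D Y\<^sup>2\<close>\<close>

lemma ex_prime_gt_dvd_square_plus:
  fixes B D :: int
  assumes "D > 0"
  shows "\<exists>l r. prime l \<and> l > B \<and> l dvd r\<^sup>2 + D"
proof -
  define w :: int where "w = fact (nat B)"
  have "D * w\<^sup>2 + 1 > 1" using assms by (simp add: w_def)
  then have "\<bar>D * w\<^sup>2 + 1\<bar> \<noteq> 1" by linarith
  then obtain l where l: "prime l" "l dvd D * w\<^sup>2 + 1" by (rule prime_factor_int)
  have "l > B"
  proof (rule ccontr)
    assume "\<not> l > B"
    then have "nat l dvd fact (nat B)"
      using prime_gt_0_int[OF l(1)] by (intro dvd_fact) auto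
    then have "int (nat l) dvd int (fact (nat B))" by (simp only: int_dvd_int_iff)
    then have "l dvd D * w\<^sup>2"
      using prime_gt_0_int[OF l(1)] by (simp add: w_def power2_eq_square)
    with l(2) have "l dvd 1" using dvd_add_right_iff by blast
    with l(1) show False by auto
  qed
  moreover have "(D * w)\<^sup>2 + D = D * (D * w\<^sup>2 + 1)"
    by (simp add: power2_eq_square algebra_simps)
  then have "l dvd (D * w)\<^sup>2 + D" using l(2) by simp
  ultimately show ?thesis using l(1) by blast
qed

lemma odd_prime_int_not_dvd_2:
  fixes l :: int
  assumes "prime l" "odd l"
  shows "\<not> l dvd 2"
  using assms by (metis dvd_refl primes_dvd_imp_eq two_is_prime)

lemma lift_sqrt_mod_prime_power:
  fixes l D r :: int
  assumes l: "prime l" "\<not> l dvd 2 * r" and root: "l ^ Suc j dvd r\<^sup>2 + D"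
  shows "\<exists>r'. l ^ Suc (Suc j) dvd r'\<^sup>2 + D \<and> l ^ Suc j dvd r' - r"
proof -
  obtain k where k: "r\<^sup>2 + D = l ^ Suc j * k" using root by (rule dvdE)
  have "coprime (2 * r) l"
    using prime_imp_coprime[OF l] by (simp add: coprime_commute)
  then obtain u where "[2 * r * u = 1] (mod l)" using cong_solve_coprime_int by blast
  then have "l dvd 2 * r * u - 1" by (simp add: cong_iff_dvd_diff)
  then obtain v where "2 * r * u - 1 = l * v" by (rule dvdE)
  then have v: "2 * r * u = 1 + l * v" by simp
  define r' where "r' = r - k * u * l ^ Suc j"
  have "r'\<^sup>2 + D = (r\<^sup>2 + D) - k * l ^ Suc j * (2 * r * u) + (k * u * l ^ Suc j)\<^sup>2"
    by (simp add: r'_def power2_eq_square algebra_simps)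
  also have "\<dots> = l ^ Suc (Suc j) * (- k * v + k\<^sup>2 * u\<^sup>2 * l ^ j)"
    unfolding v k by (simp add: power2_eq_square algebra_simps)
  finally have "l ^ Suc (Suc j) dvd r'\<^sup>2 + D" by simp
  moreover have "l ^ Suc j dvd r' - r" by (simp add: r'_def)
  ultimately show ?thesis by blast
qed

lemma ex_coherent_sqrt_mod_prime_powers:
  fixes l D r :: int
  assumes l: "prime l" "\<not> l dvd 2 * D" and root: "l dvd r\<^sup>2 + D"
  obtains \<rho> where "\<And>s. l ^ s dvd (\<rho> s)\<^sup>2 + D" "\<And>s t. s \<le> t \<Longrightarrow> l ^ s dvd \<rho> t - \<rho> s"
proof -
  have unit: "\<not> l dvd 2 * x" if "l ^ Suc j dvd x\<^sup>2 + D" for x j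
  proof
    assume "l dvd 2 * x"
    then have "l dvd x" using l by (auto simp: prime_dvd_mult_iff)
    moreover have "l dvd x\<^sup>2 + D" using that by (rule dvd_trans[rotated]) simp
    ultimately have "l dvd D" by (simp add: power2_eq_square dvd_add_right_iff)
    then show False using l(2) by simp
  qed
  have "\<exists>\<rho>. \<forall>s. l ^ Suc s dvd (\<rho> s)\<^sup>2 + D \<and> l ^ Suc s dvd \<rho> (Suc s) - \<rho> s"
  proof (rule dependent_nat_choice)
    show "\<exists>x. l ^ Suc 0 dvd x\<^sup>2 + D" using root by auto
    show "\<exists>y. l ^ Suc (Suc s) dvd y\<^sup>2 + D \<and> l ^ Suc s dvd y - x"
      if "l ^ Suc s dvd x\<^sup>2 + D" for x s
      using lift_sqrt_mod_prime_power[OF l(1) unit[OF that] that] .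
  qed
  then obtain \<rho> where \<rho>: "\<And>s. l ^ Suc s dvd (\<rho> s)\<^sup>2 + D" "\<And>s. l ^ Suc s dvd \<rho> (Suc s) - \<rho> s"
    by blast
  show thesis
  proof (rule that)
    show "l ^ s dvd (\<rho> s)\<^sup>2 + D" for s using \<rho>(1)[of s] by (simp add: dvd_mult_right)
    show "l ^ s dvd \<rho> t - \<rho> s" if "s \<le> t" for s t
      using that
    proof (induction t rule: dec_induct)
      case (step t)
      have "l ^ s dvd l ^ Suc t" using step.hyps by (intro le_imp_power_dvd) simp
      then have "l ^ s dvd (\<rho> (Suc t) - \<rho> t) + (\<rho> t - \<rho> s)"
        using \<rho>(2)[of t] step.IH dvd_trans dvd_add by blast
      then show ?case by simp
    qed simp
  qed
qed

lemma dvd_square_plus_mult_square: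
  fixes M r x y D :: int
  assumes "M dvd r\<^sup>2 + D" "M dvd x - r * y"
  shows "M dvd x\<^sup>2 + D * y\<^sup>2"
proof -
  have "x\<^sup>2 + D * y\<^sup>2 = (x - r * y) * (x + r * y) + (r\<^sup>2 + D) * y\<^sup>2"
    by (simp add: power2_eq_square algebra_simps)
  then show ?thesis using assms by simp
qed

lemma thue:
  fixes L r :: int
  assumes "L > 0"
  obtains x y where "\<bar>x\<bar> < L" "0 < y" "y \<le> L" "L\<^sup>2 dvd x - r * y"
proof -
  have "nat L > 0" using assms by simp
  then obtain h y where hy: "0 < y" "y \<le> int (nat L)"
      "\<bar>of_int y * (of_int r / of_int (L\<^sup>2)) - of_int h\<bar> < 1 / real (nat L)"
    by (rule Dirichlet_approx)
  define x where "x = y * r - h * L\<^sup>2"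
  have "\<bar>real_of_int x\<bar> = of_int (L\<^sup>2) * \<bar>of_int y * (of_int r / of_int (L\<^sup>2)) - of_int h\<bar>"
    using assms by (simp add: x_def field_simps flip: abs_mult)
  also have "\<dots> < of_int (L\<^sup>2) * (1 / real (nat L))"
    using hy(3) assms by (intro mult_strict_left_mono) auto
  also have "\<dots> = of_int L" using assms by (simp add: power2_eq_square)
  finally have "\<bar>x\<bar> < L" by linarith
  moreover have "L\<^sup>2 dvd x - r * y" by (simp add: x_def)
  moreover have "y \<le> L" using hy(2) assms by simp
  ultimately show thesis using hy(1) that by blast
qed

lemma thue_square_plus_mult_square:
  fixes L D r :: int
  assumes L: "L > 0" and D: "D > 0" and root: "L\<^sup>2 dvd r\<^sup>2 + D"
  obtains x y c where "x\<^sup>2 + D * y\<^sup>2 = c * L\<^sup>2" "0 < c" "c \<le> D" "L\<^sup>2 dvd x - r * y"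
proof -
  obtain x y where xy: "\<bar>x\<bar> < L" "0 < y" "y \<le> L" and dvd: "L\<^sup>2 dvd x - r * y"
    using thue[OF L] by blast
  obtain c where c: "x\<^sup>2 + D * y\<^sup>2 = c * L\<^sup>2"
    using dvd_square_plus_mult_square[OF root dvd] by (metis dvdE mult.commute)
  have "c * L\<^sup>2 > 0" using D xy by (simp add: add_nonneg_pos flip: c)
  then have "0 < c" by (simp add: zero_less_mult_iff)
  moreover have "c * L\<^sup>2 < (D + 1) * L\<^sup>2"
  proof -
    have "x\<^sup>2 < L\<^sup>2" using xy(1) power_strict_mono[of "\<bar>x\<bar>" L 2] by simp
    moreover have "D * y\<^sup>2 \<le> D * L\<^sup>2" using D xy by (intro mult_left_mono power_mono) auto
    ultimately show ?thesis unfolding c[symmetric] by (simp add: distrib_right)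
  qed
  then have "c \<le> D" using L by simp
  ultimately show thesis using c dvd that by blast
qed

lemma common_divisor_dvd_norm_quotient:
  fixes M r x y D g c :: int
  assumes M: "M \<noteq> 0" and root: "M dvd r\<^sup>2 + D" and dvd: "M dvd x - r * y"
    and norm: "x\<^sup>2 + D * y\<^sup>2 = c * M" and g: "g dvd M" "g dvd x" "g dvd y"
  shows "g dvd c"
proof -
  obtain M' x' y' where eqs: "M = g * M'" "x = g * x'" "y = g * y'" using g by (auto elim!: dvdE)
  have "g * M' dvd g * (x' - r * y')" using dvd by (simp add: eqs algebra_simps)
  then have "M' dvd x' - r * y'" using M by (simp add: eqs)
  moreover have "M' dvd r\<^sup>2 + D" using root by (auto simp: eqs dest: dvd_mult_right)
  ultimately have "M' dvd x'\<^sup>2 + D * y'\<^sup>2" by (intro dvd_square_plus_mult_square)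
  then have "g\<^sup>2 * M' dvd g\<^sup>2 * (x'\<^sup>2 + D * y'\<^sup>2)" by simp
  also have "\<dots> = c * (g * M')" using norm by (simp add: eqs power2_eq_square algebra_simps)
  finally show ?thesis using M by (simp add: eqs power2_eq_square mult.assoc)
qed

lemma norm_dvd_mult_conjugate:
  fixes x1 y1 x2 y2 d M r D :: int
  assumes norm: "x1\<^sup>2 + D * y1\<^sup>2 = d * M" and cop: "coprime d M" and root: "M dvd r\<^sup>2 + D"
    and root1: "M dvd x1 - r * y1" and root2: "M dvd x2 - r * y2"
    and cong: "d dvd x2 - x1" "d dvd y2 - y1"
  shows "d * M dvd x1 * x2 + D * y1 * y2" and "d * M dvd x1 * y2 - y1 * x2"
proof -
  let ?P = "x1 * x2 + D * y1 * y2" and ?Q = "x1 * y2 - y1 * x2"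
  have "?P = (x1\<^sup>2 + D * y1\<^sup>2) + x1 * (x2 - x1) + D * y1 * (y2 - y1)"
    by (simp add: power2_eq_square algebra_simps)
  then have "d dvd ?P" using cong norm by simp
  moreover have "?P = (x1 - r * y1) * x2 + r * y1 * (x2 - r * y2) + (r\<^sup>2 + D) * (y1 * y2)"
    by (simp add: power2_eq_square algebra_simps)
  then have "M dvd ?P" using root root1 root2 by simp
  ultimately show "d * M dvd ?P" using cop by (rule divides_mult)
  have "?Q = x1 * (y2 - y1) - y1 * (x2 - x1)" by (simp add: algebra_simps)
  then have "d dvd ?Q" using cong by simp
  moreover have "?Q = (x1 - r * y1) * y2 - y1 * (x2 - r * y2)" by (simp add: algebra_simps)
  then have "M dvd ?Q" using root1 root2 by simp
  ultimately show "d * M dvd ?Q" using cop by (rule divides_mult)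
qed

text \<open>This divides \<open>x\<^sub>2 + y\<^sub>2 \<surd>-D\<close> by \<open>x\<^sub>1 + y\<^sub>1 \<surd>-D\<close>: the congruences make
  \<open>(x\<^sub>2 + y\<^sub>2 \<surd>-D) (x\<^sub>1 - y\<^sub>1 \<surd>-D)\<close> divisible by the norm \<open>d M\<close>.\<close>

lemma norm_form_quotient:
  fixes x1 y1 x2 y2 d M N r D :: int
  assumes norm1: "x1\<^sup>2 + D * y1\<^sup>2 = d * M" and norm2: "x2\<^sup>2 + D * y2\<^sup>2 = d * M * N"
    and nz: "d * M \<noteq> 0" and cop: "coprime d M" and root: "M dvd r\<^sup>2 + D"
    and root1: "M dvd x1 - r * y1" and root2: "M dvd x2 - r * y2"
    and cong: "d dvd x2 - x1" "d dvd y2 - y1"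
  obtains X Y where "X\<^sup>2 + D * Y\<^sup>2 = N" "x2 = x1 * X - D * y1 * Y" "y2 = y1 * X + x1 * Y"
proof -
  define P where "P = x1 * x2 + D * y1 * y2"
  define Q where "Q = x1 * y2 - y1 * x2"
  obtain X Y where X: "P = d * M * X" and Y: "Q = d * M * Y"
    using norm_dvd_mult_conjugate[OF norm1 cop root root1 root2 cong]
    unfolding P_def Q_def dvd_def by blast
  have "(d * M)\<^sup>2 * (X\<^sup>2 + D * Y\<^sup>2) = P\<^sup>2 + D * Q\<^sup>2"
    unfolding X Y by (simp add: power2_eq_square algebra_simps)
  also have "\<dots> = (x1\<^sup>2 + D * y1\<^sup>2) * (x2\<^sup>2 + D * y2\<^sup>2)"
    unfolding P_def Q_def by (simp add: power2_eq_square algebra_simps)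
  also have "\<dots> = (d * M)\<^sup>2 * N" unfolding norm1 norm2 by (simp add: power2_eq_square)
  finally have "X\<^sup>2 + D * Y\<^sup>2 = N" using nz by simp
  moreover have "(d * M) * x2 = x1 * P - D * y1 * Q" "(d * M) * y2 = y1 * P + x1 * Q"
    unfolding norm1[symmetric] P_def Q_def by (simp_all add: power2_eq_square algebra_simps)
  then have "(d * M) * x2 = (d * M) * (x1 * X - D * y1 * Y)"
      "(d * M) * y2 = (d * M) * (y1 * X + x1 * Y)"
    unfolding X Y by (simp_all add: algebra_simps)
  ultimately show thesis using nz that mult_left_cancel by blast
qed

lemma ex_distant_congruent_bounded_moduli:
  fixes x y c :: "nat \<Rightarrow> int"
  assumes c: "\<And>k. 0 < c k" "\<And>k. c k \<le> D"
  obtains k t where "t \<ge> T" "c (k + t) = c k" "c k dvd x (k + t) - x k" "c k dvd y (k + t) - y k"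
proof -
  define residues where "residues k = (c k, x k mod c k, y k mod c k)" for k
  have "z mod c k \<in> {0..D}" for z k
    using c(2)[of k] pos_mod_sign[OF c(1), of z k] pos_mod_bound[OF c(1), of z k]
    unfolding atLeastAtMost_iff by linarith
  then have "residues k \<in> {1..D} \<times> {0..D} \<times> {0..D}" for k
    using c[of k] by (simp add: residues_def)
  then have "range residues \<subseteq> {1..D} \<times> {0..D} \<times> {0..D}" by blast
  then have "finite (range residues)" by (rule finite_subset) simp
  then obtain k where "infinite {k'. residues k' = residues k}"
    using pigeonhole_infinite[of UNIV residues] by auto
  then obtain k' where "k' \<ge> k + T" and res: "residues k' = residues k"
    unfolding infinite_nat_iff_unbounded_le by blast
  then obtain t where t: "k' = k + t" "t \<ge> T" by (auto dest!: le_Suc_ex)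
  show thesis
    using that[OF t(2), of k] res by (auto simp: residues_def t mod_eq_dvd_iff)
qed

lemma ex_coherent_norm_multiples_prime_powers:
  fixes l D :: int
  assumes l: "prime l" "\<not> l dvd 2 * D" and D: "D > 0" and root: "l dvd r\<^sup>2 + D"
  obtains \<rho> x y c where "\<And>k. l ^ k dvd (\<rho> k)\<^sup>2 + D"
    and "\<And>k. (x k)\<^sup>2 + D * (y k)\<^sup>2 = c k * l ^ (2 * k)" "\<And>k. 0 < c k" "\<And>k. c k \<le> D"
    and "\<And>j k. j \<le> k \<Longrightarrow> l ^ (2 * j) dvd x k - \<rho> (2 * j) * y k"
proof -
  obtain \<rho> where \<rho>: "\<And>k. l ^ k dvd (\<rho> k)\<^sup>2 + D" "\<And>j k. j \<le> k \<Longrightarrow> l ^ j dvd \<rho> k - \<rho> j"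
    using ex_coherent_sqrt_mod_prime_powers[OF l root] by metis
  have "\<exists>x y c. x\<^sup>2 + D * y\<^sup>2 = c * l ^ (2 * k) \<and> 0 < c \<and> c \<le> D \<and>
      l ^ (2 * k) dvd x - \<rho> (2 * k) * y" for k
    using thue_square_plus_mult_square[of "l ^ k" D "\<rho> (2 * k)"] \<rho>(1)[of "2 * k"] D
      prime_gt_0_int[OF l(1)]
    by (metis power_even_eq zero_less_power)
  then obtain x y c where norm: "\<And>k. (x k)\<^sup>2 + D * (y k)\<^sup>2 = c k * l ^ (2 * k)"
    and c: "\<And>k. 0 < c k" "\<And>k. c k \<le> D"
    and dvd: "\<And>k. l ^ (2 * k) dvd x k - \<rho> (2 * k) * y k"
    by metis
  have "l ^ (2 * j) dvd x k - \<rho> (2 * j) * y k" if "j \<le> k" for j k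
  proof -
    have "l ^ (2 * j) dvd l ^ (2 * k)" using that by (intro le_imp_power_dvd) simp
    then have "l ^ (2 * j) dvd (x k - \<rho> (2 * k) * y k) + (\<rho> (2 * k) - \<rho> (2 * j)) * y k"
      using dvd[of k] \<rho>(2)[of "2 * j" "2 * k"] that
      by (intro dvd_add dvd_mult2) (auto intro: dvd_trans)
    then show ?thesis by (simp add: algebra_simps)
  qed
  then show thesis using that \<rho> norm c by blast
qed

lemma ex_primitive_square_plus_mult_square_eq_prime_power:
  fixes l D :: int
  assumes l: "prime l" "odd l" "l > D" and D: "D > 0" and root: "l dvd r\<^sup>2 + D"
  obtains t X Y where "t > T" "X\<^sup>2 + D * Y\<^sup>2 = l ^ (2 * t)" "\<not> (l dvd X \<and> l dvd Y)"
proof -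
  have not_dvd: "\<not> l dvd d" if "0 < d" "d \<le> D" for d
    using that l(3) zdvd_not_zless[of d l] by simp
  have "\<not> l dvd 2 * D"
    using not_dvd[of D] D l(1) odd_prime_int_not_dvd_2[OF l(1,2)] by (simp add: prime_dvd_mult_iff)
  then obtain \<rho> x y c where \<rho>: "\<And>k. l ^ k dvd (\<rho> k)\<^sup>2 + D"
    and norm: "\<And>k. (x k)\<^sup>2 + D * (y k)\<^sup>2 = c k * l ^ (2 * k)"
    and c: "\<And>k. 0 < c k" "\<And>k. c k \<le> D"
    and dvd: "\<And>j k. j \<le> k \<Longrightarrow> l ^ (2 * j) dvd x k - \<rho> (2 * j) * y k"
    using ex_coherent_norm_multiples_prime_powers[OF l(1) _ D root] by metis
  obtain k t where t: "t > T"
    and cong: "c (k + t) = c k" "c k dvd x (k + t) - x k" "c k dvd y (k + t) - y k"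
    using ex_distant_congruent_bounded_moduli[where c = c and x = x and y = y and T = "Suc T", OF c]
    by (metis Suc_le_eq)
  have "(x (k + t))\<^sup>2 + D * (y (k + t))\<^sup>2 = c k * l ^ (2 * k) * l ^ (2 * t)"
    using norm[of "k + t"] cong(1) by (simp add: power_add distrib_left)
  moreover have "coprime (c k) (l ^ (2 * k))"
    using prime_imp_coprime[OF l(1) not_dvd[OF c]] by (simp add: coprime_commute)
  moreover have "c k * l ^ (2 * k) \<noteq> 0" using c(1)[of k] prime_gt_0_int[OF l(1)] by simp
  ultimately obtain X Y where XY: "X\<^sup>2 + D * Y\<^sup>2 = l ^ (2 * t)"
      "x (k + t) = x k * X - D * y k * Y" "y (k + t) = y k * X + x k * Y"
    using norm_form_quotient[OF norm[of k] _ _ _ \<rho> dvd dvd cong(2,3)] by (metis le_add1 order_refl)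
  have "\<not> (l dvd X \<and> l dvd Y)"
  proof
    assume "l dvd X \<and> l dvd Y"
    then have "l dvd x (k + t)" "l dvd y (k + t)" by (simp_all add: XY)
    moreover have "l dvd l ^ (2 * (k + t))" using t by (intro dvd_power) simp
    moreover have "l ^ (2 * (k + t)) \<noteq> 0" using prime_gt_0_int[OF l(1)] by simp
    ultimately have "l dvd c (k + t)"
      using common_divisor_dvd_norm_quotient[OF _ \<rho> dvd[OF order_refl] norm] by blast
    then show False using not_dvd c by blast
  qed
  then show thesis using that XY(1) t by blast
qed

section \<open>Representation numbers of diagonal binary forms\<close>

definition representations :: "int \<Rightarrow> int \<Rightarrow> int \<Rightarrow> (int \<times> int) set" where
  "representations q p N = {(m, n). 0 < m \<and> 0 < n \<and> q * m\<^sup>2 + p * n\<^sup>2 = N}"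

definition primitive_representations :: "int \<Rightarrow> int \<Rightarrow> int \<Rightarrow> int \<Rightarrow> (int \<times> int) set" where
  "primitive_representations l q p N = {(m, n) \<in> representations q p N. \<not> (l dvd m \<and> l dvd n)}"

lemma finite_representations:
  assumes "0 < q" "0 < p"
  shows "finite (representations q p N)"
proof (rule finite_subset)
  show "representations q p N \<subseteq> {0..N} \<times> {0..N}"
  proof (clarsimp simp: representations_def)
    fix m n :: int
    assume "0 < m" "0 < n"
    have "1 * x \<le> c * x\<^sup>2" if "0 < c" "0 < x" for c x :: int
      using that by (intro mult_mono) (auto simp: power2_eq_square)
    then have "m \<le> q * m\<^sup>2" "n \<le> p * n\<^sup>2" using assms \<open>0 < m\<close> \<open>0 < n\<close> by auto
    then show "m \<le> q * m\<^sup>2 + p * n\<^sup>2 \<and> n \<le> q * m\<^sup>2 + p * n\<^sup>2"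
      using \<open>0 < m\<close> \<open>0 < n\<close> by linarith
  qed
qed simp

lemma finite_primitive_representations:
  assumes "0 < q" "0 < p"
  shows "finite (primitive_representations l q p N)"
  by (rule finite_subset[OF _ finite_representations[OF assms]])
    (auto simp: primitive_representations_def)

lemma card_representations_mult_square:
  assumes "0 < l" "0 < q" "0 < p"
  shows "card (representations q p (l\<^sup>2 * N)) =
    card (representations q p N) + card (primitive_representations l q p (l\<^sup>2 * N))"
proof -
  let ?scale = "\<lambda>(m, n). (l * m, l * n)"
  have scaled: "(l * m, l * n) \<in> representations q p (l\<^sup>2 * N) \<longleftrightarrow>
      (m, n) \<in> representations q p N" for m n
  proof -
    have "q * (l * m)\<^sup>2 + p * (l * n)\<^sup>2 = l\<^sup>2 * (q * m\<^sup>2 + p * n\<^sup>2)"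
      by (simp add: power2_eq_square algebra_simps)
    then show ?thesis using assms by (simp add: representations_def zero_less_mult_iff)
  qed
  have "representations q p (l\<^sup>2 * N) =
      ?scale ` representations q p N \<union> primitive_representations l q p (l\<^sup>2 * N)"
  proof (intro equalityI subsetI)
    fix z assume z: "z \<in> representations q p (l\<^sup>2 * N)"
    obtain m n where mn: "z = (m, n)" by fastforce
    show "z \<in> ?scale ` representations q p N \<union> primitive_representations l q p (l\<^sup>2 * N)"
    proof (cases "l dvd m \<and> l dvd n")
      case True
      then obtain m' n' where "m = l * m'" "n = l * n'" by (auto elim!: dvdE)
      then have "z = ?scale (m', n')" "(m', n') \<in> representations q p N" using z mn scaled by auto
      then show ?thesis by blast
    qed (use z mn in \<open>simp add: primitive_representations_def\<close>)
  qed (auto simp: scaled primitive_representations_def)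
  moreover have "?scale ` representations q p N \<inter> primitive_representations l q p (l\<^sup>2 * N) = {}"
    by (auto simp: primitive_representations_def)
  moreover have "inj_on ?scale (representations q p N)"
    using assms(1) by (auto simp: inj_on_def)
  ultimately show ?thesis
    using finite_representations[OF assms(2,3)] finite_primitive_representations[OF assms(2,3)]
    by (simp add: card_Un_disjoint card_image)
qed

text \<open>For \<open>Y = m\<^sub>1 n\<^sub>2 \<minusplus> m\<^sub>2 n\<^sub>1\<close> the hypothesis is Brahmagupta's identity
  \<open>(q m\<^sub>1\<^sup>2 + p n\<^sub>1\<^sup>2) (q m\<^sub>2\<^sup>2 + p n\<^sub>2\<^sup>2) = (q m\<^sub>1 m\<^sub>2 \<plusminus> p n\<^sub>1 n\<^sub>2)\<^sup>2 + p q Y\<^sup>2\<close>.\<close>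

lemma dvd_imp_eq_0_of_square_plus_eq:
  fixes X Y L p q :: int
  assumes dvd: "L dvd Y" and eq: "X\<^sup>2 + p * q * Y\<^sup>2 = (q * L)\<^sup>2" and "0 < L" "0 < q" "q < p"
  shows "Y = 0"
proof (rule ccontr)
  assume "Y \<noteq> 0"
  then have "L\<^sup>2 \<le> Y\<^sup>2"
    using dvd_imp_le_int[OF _ dvd] \<open>0 < L\<close> by (simp flip: abs_le_square_iff)
  then have "p * q * L\<^sup>2 \<le> p * q * Y\<^sup>2" using assms by simp
  also have "\<dots> \<le> (q * L)\<^sup>2" unfolding eq[symmetric] by simp
  finally have "p * (q * L\<^sup>2) \<le> q * (q * L\<^sup>2)" by (simp add: power2_eq_square mult_ac)
  then show False using assms by simp
qed

lemma representations_eq_if_proportional: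
  assumes repr: "(m1, n1) \<in> representations q p N" "(m2, n2) \<in> representations q p N"
    and pq: "0 < q" "0 < p" and ray: "m1 * n2 = m2 * n1"
  shows "(m1, n1) = (m2, n2)"
proof -
  have pos: "0 < m1" "0 < n1" "0 < m2" "0 < n2"
    and eq: "q * m1\<^sup>2 + p * n1\<^sup>2 = N" "q * m2\<^sup>2 + p * n2\<^sup>2 = N"
    using repr by (simp_all add: representations_def)
  have "N * n2\<^sup>2 = q * (m1 * n2)\<^sup>2 + p * n1\<^sup>2 * n2\<^sup>2"
    unfolding eq(1)[symmetric] by (simp add: power2_eq_square algebra_simps)
  also have "\<dots> = N * n1\<^sup>2"
    unfolding ray eq(2)[symmetric] by (simp add: power2_eq_square algebra_simps)
  finally have "N * n2\<^sup>2 = N * n1\<^sup>2" .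
  moreover have "N > 0" using pq pos by (simp add: add_pos_pos flip: eq(1))
  ultimately have "n1 = n2" using pos by (simp add: power2_eq_iff_nonneg)
  then show ?thesis using ray pos by simp
qed

lemma primitive_representation_not_dvd:
  assumes l: "prime l" "\<not> l dvd q" "\<not> l dvd p" "l dvd N"
    and prim: "(m, n) \<in> primitive_representations l q p N"
  shows "\<not> l dvd m" "\<not> l dvd n"
proof -
  have "q * m\<^sup>2 + p * n\<^sup>2 = N" and nd: "\<not> (l dvd m \<and> l dvd n)"
    using prim by (simp_all add: primitive_representations_def representations_def)
  then have "l dvd q * m\<^sup>2 \<longleftrightarrow> l dvd p * n\<^sup>2"
    using l(4) dvd_add_right_iff dvd_add_left_iff by metis
  then have "l dvd m \<longleftrightarrow> l dvd n" using l by (simp add: prime_dvd_mult_iff prime_dvd_power_iff)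
  with nd show "\<not> l dvd m" "\<not> l dvd n" by auto
qed

lemma prime_power_dvd_mult_imp_dvd_or_dvd:
  fixes l A B :: int
  assumes "prime l" "\<not> l dvd A + B" "l ^ s dvd A * B"
  shows "l ^ s dvd A \<or> l ^ s dvd B"
proof -
  have "\<not> l dvd A \<or> \<not> l dvd B" using assms(2) by auto
  then have "coprime (l ^ s) A \<or> coprime (l ^ s) B"
    using prime_imp_coprime[OF assms(1)] by auto
  then show ?thesis
    using assms(3) by (auto simp: coprime_dvd_mult_right_iff coprime_dvd_mult_left_iff)
qed

lemma card_primitive_representations_le_1:
  fixes l p q :: int
  assumes l: "prime l" "odd l" "\<not> l dvd q" "\<not> l dvd p" and pq: "0 < q" "q < p" and "0 < s"
  shows "card (primitive_representations l q p (q * l ^ s)) \<le> 1"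
proof -
  let ?P = "primitive_representations l q p (q * l ^ s)"
  have "z1 = z2" if "z1 \<in> ?P" "z2 \<in> ?P" for z1 z2
  proof -
    obtain m1 n1 m2 n2 where z: "z1 = (m1, n1)" "z2 = (m2, n2)" by fastforce
    have pos: "0 < m1" "0 < n1" "0 < m2" "0 < n2"
      and eq1: "q * m1\<^sup>2 + p * n1\<^sup>2 = q * l ^ s" and eq2: "q * m2\<^sup>2 + p * n2\<^sup>2 = q * l ^ s"
      using that unfolding z by (simp_all add: primitive_representations_def representations_def)
    define A where "A = m1 * n2 - m2 * n1"
    define B where "B = m1 * n2 + m2 * n1"
    have "q * (A * B) = (q * m1\<^sup>2 + p * n1\<^sup>2) * n2\<^sup>2 - (q * m2\<^sup>2 + p * n2\<^sup>2) * n1\<^sup>2"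
      unfolding A_def B_def by (simp add: power2_eq_square algebra_simps)
    also have "\<dots> = q * (l ^ s * (n2\<^sup>2 - n1\<^sup>2))" unfolding eq1 eq2 by (simp add: algebra_simps)
    finally have AB: "l ^ s dvd A * B" using pq by simp
    have "l dvd q * l ^ s" using \<open>0 < s\<close> by (simp add: dvd_power)
    then have "\<not> l dvd m1" "\<not> l dvd n2"
      using primitive_representation_not_dvd[OF l(1,3,4)] that unfolding z by blast+
    then have "\<not> l dvd 2 * (m1 * n2)"
      using l(1) odd_prime_int_not_dvd_2[OF l(1,2)] by (simp add: prime_dvd_mult_iff)
    also have "2 * (m1 * n2) = A + B" by (simp add: A_def B_def)
    finally have dvd: "l ^ s dvd A \<or> l ^ s dvd B"
      using prime_power_dvd_mult_imp_dvd_or_dvd[OF l(1) _ AB] by blast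
    have "(q * m1 * m2 + p * n1 * n2)\<^sup>2 + p * q * A\<^sup>2 = (q * m1\<^sup>2 + p * n1\<^sup>2) * (q * m2\<^sup>2 + p * n2\<^sup>2)"
      "(q * m1 * m2 - p * n1 * n2)\<^sup>2 + p * q * B\<^sup>2 = (q * m1\<^sup>2 + p * n1\<^sup>2) * (q * m2\<^sup>2 + p * n2\<^sup>2)"
      unfolding A_def B_def by (simp_all add: power2_eq_square algebra_simps)
    then have "A = 0 \<or> B = 0"
      using dvd dvd_imp_eq_0_of_square_plus_eq[of "l ^ s" _ _ p q] pq prime_gt_0_int[OF l(1)]
      unfolding eq1 eq2 power2_eq_square[of "q * l ^ s", symmetric] by (metis zero_less_power)
    moreover have "B > 0" using pos by (simp add: B_def add_pos_pos)
    ultimately have "m1 * n2 = m2 * n1" by (simp add: A_def)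
    then show ?thesis
      using that pq representations_eq_if_proportional[of m1 n1 q p "q * l ^ s" m2 n2]
      unfolding z by (simp add: primitive_representations_def)
  qed
  then show ?thesis using card_le_Suc0_iff_eq[of ?P] finite_primitive_representations pq by simp
qed

lemma primitive_representations_nonempty:
  assumes l: "prime l" "\<not> l dvd q" "\<not> l dvd p" and pq: "0 < q" and "0 < s"
    and norm: "X\<^sup>2 + p * q * Y\<^sup>2 = l ^ s" and prim: "\<not> (l dvd X \<and> l dvd Y)"
  shows "primitive_representations l q p (q * l ^ s) \<noteq> {}"
proof -
  have "l dvd X\<^sup>2 + p * q * Y\<^sup>2" using \<open>0 < s\<close> unfolding norm by (simp add: dvd_power)
  then have "l dvd X\<^sup>2 \<longleftrightarrow> l dvd p * q * Y\<^sup>2"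
    using dvd_add_right_iff dvd_add_left_iff by blast
  then have nd: "\<not> l dvd X" "\<not> l dvd Y"
    using prim l by (auto simp: prime_dvd_mult_iff prime_dvd_power_iff)
  have "q * \<bar>X\<bar>\<^sup>2 + p * (q * \<bar>Y\<bar>)\<^sup>2 = q * (X\<^sup>2 + p * q * Y\<^sup>2)"
    by (simp add: power2_eq_square algebra_simps)
  then have "(\<bar>X\<bar>, q * \<bar>Y\<bar>) \<in> primitive_representations l q p (q * l ^ s)"
    using nd pq
    by (auto intro!: mult_pos_pos simp: primitive_representations_def representations_def norm)
  then show ?thesis by blast
qed

lemma nat_unit_steps_surj:
  fixes f :: "nat \<Rightarrow> nat"
  assumes "f 0 = 0" "mono f" and step: "\<And>j. f (Suc j) \<le> Suc (f j)"
    and incr: "\<And>T. \<exists>t\<ge>T. f t < f (Suc t)"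
  shows "surj f"
  unfolding surj_def
proof
  fix k
  have "\<exists>n. k \<le> f n"
  proof (induction k)
    case (Suc k)
    then obtain n where "k \<le> f n" by blast
    moreover obtain t where "t \<ge> n" "f t < f (Suc t)" using incr by blast
    ultimately have "Suc k \<le> f (Suc t)" using monoD[OF \<open>mono f\<close>, of n t] by linarith
    then show ?case by blast
  qed simp
  then obtain n where n: "k \<le> f n" by blast
  have "\<exists>j\<le>n. int (f j) = int k"
  proof (rule nat0_intermed_int_val)
    show "\<forall>i<n. \<bar>int (f (i + 1)) - int (f i)\<bar> \<le> 1"
    proof (intro allI impI)
      show "\<bar>int (f (i + 1)) - int (f i)\<bar> \<le> 1" for i
        using step[of i] monoD[OF \<open>mono f\<close>, of i "Suc i"] by simp
    qed
  qed (use n \<open>f 0 = 0\<close> in simp_all)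
  then show "\<exists>j. k = f j" by auto
qed

lemma representations_leading_coefficient_eq_empty:
  assumes "0 < q" "q < p"
  shows "representations q p q = {}"
proof -
  have "q * m\<^sup>2 + p * n\<^sup>2 \<noteq> q" if "0 < m" "0 < n" for m n
  proof -
    have "p * 1 \<le> p * n\<^sup>2"
      using that assms by (intro mult_left_mono) (auto simp: int_one_le_iff_zero_less)
    moreover have "0 < q * m\<^sup>2" using that assms by simp
    ultimately show ?thesis using assms by linarith
  qed
  then show ?thesis by (auto simp: representations_def)
qed

lemma card_representations_power_Suc:
  assumes "0 < l" "0 < q" "0 < p"
  shows "card (representations q p (q * (l ^ Suc j)\<^sup>2)) =
    card (representations q p (q * (l ^ j)\<^sup>2)) +
    card (primitive_representations l q p (q * l ^ (2 * Suc j)))"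
proof -
  have eqs: "q * (l ^ Suc j)\<^sup>2 = l\<^sup>2 * (q * (l ^ j)\<^sup>2)" "q * l ^ (2 * Suc j) = l\<^sup>2 * (q * (l ^ j)\<^sup>2)"
    by (simp_all add: power2_eq_square power_mult power_mult_distrib)
  show ?thesis unfolding eqs by (rule card_representations_mult_square[OF assms])
qed

lemma ex_odd_card_representations_mult_square_eq:
  fixes p q :: int
  assumes pq: "0 < q" "q < p"
  shows "\<exists>z. odd z \<and> z > 0 \<and> card (representations q p (q * z\<^sup>2)) = k"
proof -
  obtain l r where l: "prime l" "l > 2 * (p * q)" and root: "l dvd r\<^sup>2 + p * q"
    using ex_prime_gt_dvd_square_plus[of "p * q" "2 * (p * q)"] pq by auto
  have "p * q > 0" using pq by simp
  then have D: "p * q > 0" "l > p * q" using l(2) by linarith+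
  have "odd l" using l D(1) prime_odd_int[of l] by simp
  have "\<not> l dvd p * q" using zdvd_not_zless[OF D] .
  then have nd: "\<not> l dvd q" "\<not> l dvd p" by auto
  define f where "f j = card (representations q p (q * (l ^ j)\<^sup>2))" for j
  define new where "new j = card (primitive_representations l q p (q * l ^ (2 * Suc j)))" for j
  have f_Suc: "f (Suc j) = f j + new j" for j
    using card_representations_power_Suc[OF prime_gt_0_int[OF l(1)] pq(1)] pq
    by (simp add: f_def new_def)
  have "surj f"
  proof (rule nat_unit_steps_surj)
    show "f 0 = 0" by (simp add: f_def representations_leading_coefficient_eq_empty pq)
    show "mono f" by (simp add: mono_iff_le_Suc f_Suc)
    show "f (Suc j) \<le> Suc (f j)" for j
      using card_primitive_representations_le_1[OF l(1) \<open>odd l\<close> nd pq, of "2 * Suc j"]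
      by (simp add: f_Suc new_def)
    show "\<exists>t\<ge>T. f t < f (Suc t)" for T
    proof -
      obtain t X Y where t: "t > T" and XY: "X\<^sup>2 + p * q * Y\<^sup>2 = l ^ (2 * t)" "\<not> (l dvd X \<and> l dvd Y)"
        using ex_primitive_square_plus_mult_square_eq_prime_power[OF l(1) \<open>odd l\<close> D(2,1) root]
        by metis
      then have "primitive_representations l q p (q * l ^ (2 * t)) \<noteq> {}"
        using primitive_representations_nonempty[OF l(1) nd pq(1) _ XY] by simp
      moreover obtain t' where "t = Suc t'" using t by (cases t) auto
      ultimately have "new t' \<noteq> 0" "t' \<ge> T"
        using finite_primitive_representations pq t by (auto simp: new_def)
      then show ?thesis by (auto simp: f_Suc)
    qed
  qed
  then obtain j where "f j = k" by (metis surjD)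
  then show ?thesis
    using \<open>odd l\<close> prime_gt_0_int[OF l(1)] by (intro exI[of _ "l ^ j"]) (simp add: f_def)
qed

lemma representations_1_1_eq_Un:
  assumes "odd N"
  shows "representations 1 1 N =
    map_prod id ((*) 2) ` representations 1 4 N \<union>
    prod.swap ` map_prod id ((*) 2) ` representations 1 4 N"
    (is "_ = ?S \<union> prod.swap ` ?S")
proof (intro equalityI subsetI)
  have mem: "(m, n) \<in> ?S" if "0 < m" "0 < n" "m\<^sup>2 + n\<^sup>2 = N" "even n" for m n
  proof -
    obtain n' where "n = 2 * n'" using \<open>even n\<close> by (rule evenE)
    then show ?thesis
      using that
      by (auto intro!: image_eqI[of _ _ "(m, n')"] simp: representations_def power_mult_distrib)
  qed
  fix z assume "z \<in> representations 1 1 N"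
  then obtain m n where mn: "z = (m, n)" "0 < m" "0 < n" "m\<^sup>2 + n\<^sup>2 = N"
    by (auto simp: representations_def)
  then have "even m \<or> even n" using assms by auto
  then show "z \<in> ?S \<union> prod.swap ` ?S"
    using mem[of m n] mem[of n m] mn by (force simp: add.commute)
qed (auto simp: representations_def power_mult_distrib)

lemma card_representations_1_1_odd:
  assumes "odd N"
  shows "card (representations 1 1 N) = 2 * card (representations 1 4 N)"
proof -
  let ?S = "map_prod id ((*) 2) ` representations 1 4 N"
  have "finite ?S" by (simp add: finite_representations)
  moreover have "?S \<inter> prod.swap ` ?S = {}"
  proof -
    have "odd m" if "(m, n) \<in> representations 1 4 N" for m n
      using that assms by (auto simp: representations_def)
    then show ?thesis by fastforce
  qed
  moreover have "inj_on (map_prod id ((*) 2)) (representations 1 4 N)"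
    by (auto simp: inj_on_def)
  ultimately show ?thesis
    using assms by (simp add: representations_1_1_eq_Un card_Un_disjoint card_image)
qed

definition descending_representations :: "int \<Rightarrow> (int \<times> int) set" where
  "descending_representations N = {(m, n) \<in> representations 1 1 N. n < m}"

lemma card_representations_1_1:
  "card (representations 1 1 N) =
    2 * card (descending_representations N) + card (representations 1 1 N \<inter> Id)"
proof -
  let ?A = "descending_representations N" and ?D = "representations 1 1 N \<inter> Id"
  have "representations 1 1 N = (?A \<union> prod.swap ` ?A) \<union> ?D"
    by (force simp: descending_representations_def representations_def image_iff)
  moreover have "?A \<inter> prod.swap ` ?A = {}" "(?A \<union> prod.swap ` ?A) \<inter> ?D = {}"
    by (auto simp: descending_representations_def)
  moreover have "finite ?A" "finite ?D"
    using finite_representations[of 1 1 N]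
    by (auto simp: descending_representations_def intro: finite_subset[rotated])
  ultimately show ?thesis
    using card_Un_disjoint[of "?A \<union> prod.swap ` ?A" ?D] card_Un_disjoint[of ?A "prod.swap ` ?A"]
    by (simp add: card_image)
qed

lemma card_descending_representations_double:
  "card (descending_representations (2 * N)) = card (descending_representations N)"
proof -
  have "bij_betw (\<lambda>(s, t). (s + t, s - t))
      (descending_representations N) (descending_representations (2 * N))"
  proof (rule bij_betwI')
    fix z assume "z \<in> descending_representations (2 * N)"
    then obtain m n where mn: "z = (m, n)" "0 < n" "n < m" "m\<^sup>2 + n\<^sup>2 = 2 * N"
      by (auto simp: descending_representations_def representations_def)
    then have "even (m\<^sup>2 + n\<^sup>2)" by simp
    then have "even (m - n)" by simp
    then obtain t where "m - n = 2 * t" by (rule evenE)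
    then have t: "m = n + 2 * t" by simp
    then have "(n + t, t) \<in> descending_representations N"
      using mn
      by (auto simp: descending_representations_def representations_def power2_eq_square algebra_simps)
    then show "\<exists>w \<in> descending_representations N. z = (\<lambda>(s, t). (s + t, s - t)) w"
      by (rule bexI[rotated]) (simp add: mn t)
  qed (auto simp: descending_representations_def representations_def power2_eq_square algebra_simps)
  then show ?thesis by (simp add: bij_betw_same_card)
qed

lemma card_representations_1_1_twice_odd_square:
  assumes "odd z" "z > 0"
  shows "card (representations 1 1 (2 * z\<^sup>2)) = Suc (card (representations 1 1 (z\<^sup>2)))"
proof -
  have "m\<^sup>2 + m\<^sup>2 = 2 * z\<^sup>2 \<longleftrightarrow> m = z" if "0 < m" for m :: int
    using that assms(2) by (simp add: power2_eq_iff_nonneg flip: mult_2)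
  then have "representations 1 1 (2 * z\<^sup>2) \<inter> Id = {(z, z)}"
    using assms(2) by (auto simp: representations_def)
  moreover have "m\<^sup>2 + m\<^sup>2 \<noteq> z\<^sup>2" for m
    using assms(1) by (metis even_add even_power zero_less_numeral)
  then have "representations 1 1 (z\<^sup>2) \<inter> Id = {}"
    by (auto simp: representations_def)
  ultimately show ?thesis
    using card_representations_1_1[of "2 * z\<^sup>2"] card_representations_1_1[of "z\<^sup>2"]
    by (simp add: card_descending_representations_double)
qed

lemma card_representations_commute:
  "card (representations q p N) = card (representations p q N)"
proof -
  have "representations p q N = prod.swap ` representations q p N"
    by (force simp: representations_def image_iff add.commute)
  then show ?thesis by (simp add: card_image)
qed

lemma ex_card_representations_eq:
  assumes "0 < q" "0 < p"
  shows "\<exists>N. card (representations q p N) = k"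
proof -
  consider (less) "q < p" | (greater) "p < q" | (equal) "p = q" by linarith
  then show ?thesis
  proof cases
    case equal
    have scale: "representations q p (q * N) = representations 1 1 N" for N
      using equal assms by (simp add: representations_def flip: distrib_left)
    obtain z where z: "odd z" "z > 0" "card (representations 1 4 (z\<^sup>2)) = k div 2"
      using ex_odd_card_representations_mult_square_eq[of 1 4 "k div 2"] by auto
    have "card (representations 1 1 (z\<^sup>2)) = 2 * (k div 2)"
      using card_representations_1_1_odd[of "z\<^sup>2"] z by simp
    then have "card (representations 1 1 (z\<^sup>2)) = k \<or> card (representations 1 1 (2 * z\<^sup>2)) = k"
      using card_representations_1_1_twice_odd_square[OF z(1,2)] by presburger
    then show ?thesis using scale by metis
  qed (use ex_odd_card_representations_mult_square_eq assms card_representations_commute in metis)+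
qed

section \<open>Partial derivatives\<close>

definition has_C1_partials ::
    "(real \<times> real) set \<Rightarrow> (real \<times> real \<Rightarrow> real) \<Rightarrow>
      (real \<times> real \<Rightarrow> real) \<Rightarrow> (real \<times> real \<Rightarrow> real) \<Rightarrow> bool" where
  "has_C1_partials U u ux uy \<longleftrightarrow>
     (\<forall>x y. (x, y) \<in> U \<longrightarrow>
       ((\<lambda>s. u (s, y)) has_real_derivative ux (x, y)) (at x) \<and>
       ((\<lambda>t. u (x, t)) has_real_derivative uy (x, y)) (at y)) \<and>
     continuous_on U ux \<and> continuous_on U uy"

lemma C1_on_iff_has_C1_partials: "C1_on U u \<longleftrightarrow> has_C1_partials U u (partial_x u) (partial_y u)"
  by (auto simp: C1_on_def has_C1_partials_def
      partial_x_def partial_y_def DERIV_deriv_iff_real_differentiable)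

lemma has_C1_partials_unique:
  assumes "has_C1_partials U u ux uy" "p \<in> U"
  shows "partial_x u p = ux p" "partial_y u p = uy p"
  using assms
  by (cases p; auto simp: has_C1_partials_def partial_x_def partial_y_def intro: DERIV_imp_deriv)+

lemma has_C1_partials_cong:
  assumes U: "open U" and w: "has_C1_partials U w wx wy"
    and eq: "\<And>p. p \<in> U \<Longrightarrow> u p = w p" "\<And>p. p \<in> U \<Longrightarrow> ux p = wx p" "\<And>p. p \<in> U \<Longrightarrow> uy p = wy p"
  shows "has_C1_partials U u ux uy"
  unfolding has_C1_partials_def
proof (intro conjI allI impI)
  fix x y assume p: "(x, y) \<in> U"
  have "open ((\<lambda>s. (s, y)) -` U)" "open ((\<lambda>t. (x, t)) -` U)"
    by (intro open_vimage U continuous_intros)+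
  moreover have "((\<lambda>s. w (s, y)) has_real_derivative wx (x, y)) (at x)"
    "((\<lambda>t. w (x, t)) has_real_derivative wy (x, y)) (at y)"
    using w p by (auto simp: has_C1_partials_def)
  ultimately show "((\<lambda>s. u (s, y)) has_real_derivative ux (x, y)) (at x)"
    "((\<lambda>t. u (x, t)) has_real_derivative uy (x, y)) (at y)"
    unfolding eq(2,3)[OF p]
    using p
    by (auto intro: has_field_derivative_transform_within_open[where S = "(\<lambda>s. (s, y)) -` U"]
        has_field_derivative_transform_within_open[where S = "(\<lambda>t. (x, t)) -` U"] simp: eq(1))
next
  show "continuous_on U ux" "continuous_on U uy"
    using w eq(2,3) by (auto simp: has_C1_partials_def cong: continuous_on_cong)
qed

lemma has_C1_partials_imp_C1_on:
  assumes "open U" "has_C1_partials U u ux uy"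
  shows "C1_on U u"
  unfolding C1_on_iff_has_C1_partials
  by (rule has_C1_partials_cong[OF assms]) (simp_all add: has_C1_partials_unique[OF assms(2)])

lemma has_C1_partials_imp_C2_on:
  assumes U: "open U" and u: "has_C1_partials U u ux uy"
    and ux: "has_C1_partials U ux uxx uxy" and uy: "has_C1_partials U uy uyx uyy"
  shows "C2_on U u" "\<And>p. p \<in> U \<Longrightarrow> laplacian u p = uxx p + uyy p"
proof -
  have partials: "has_C1_partials U (partial_x u) uxx uxy" "has_C1_partials U (partial_y u) uyx uyy"
    by (rule has_C1_partials_cong[OF U ux] has_C1_partials_cong[OF U uy];
        simp add: has_C1_partials_unique[OF u])+
  then show "C2_on U u"
    using has_C1_partials_imp_C1_on[OF U] u by (auto simp: C2_on_def)
  show "laplacian u p = uxx p + uyy p" if "p \<in> U" for p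
    using partials[THEN has_C1_partials_unique(1)] partials[THEN has_C1_partials_unique(2)] that
    by (simp add: laplacian_def)
qed

definition homothety :: "'a::real_vector \<Rightarrow> real \<Rightarrow> 'a \<Rightarrow> 'a" where
  "homothety z t p = z + t *\<^sub>R (p - z)"

lemma continuous_on_homothety [continuous_intros]:
  fixes f :: "'b::topological_space \<Rightarrow> 'a::real_normed_vector"
  assumes "continuous_on S r" "continuous_on S f"
  shows "continuous_on S (\<lambda>p. homothety z (r p) (f p))"
  unfolding homothety_def by (intro continuous_intros assms)

lemma homothety_1 [simp]: "homothety z 1 p = p"
  by (simp add: homothety_def)

lemma homothety_mem_convex:
  assumes "convex S" "z \<in> S" "p \<in> S" "0 \<le> t" "t \<le> 1"
  shows "homothety z t p \<in> S"
  using convexD_alt[OF assms] by (simp add: homothety_def algebra_simps)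

lemma homothety_mem_interior:
  fixes S :: "'a::euclidean_space set"
  assumes "convex S" "z \<in> interior S" "p \<in> S" "0 \<le> t" "t < 1"
  shows "homothety z t p \<in> interior S"
  using mem_interior_convex_shrink[of S z p "1 - t"] assms
  by (simp add: homothety_def algebra_simps)

lemma has_C1_partials_homothety:
  assumes "has_C1_partials U u ux uy"
  shows "has_C1_partials (homothety z t -` U) (\<lambda>p. c * u (homothety z t p))
    (\<lambda>p. c * t * ux (homothety z t p)) (\<lambda>p. c * t * uy (homothety z t p))"
  unfolding has_C1_partials_def
proof (intro conjI allI impI)
  fix x y assume "(x, y) \<in> homothety z t -` U"
  then obtain x' y' where p': "homothety z t (x, y) = (x', y')" "(x', y') \<in> U"
    and x': "x' = fst z + t * (x - fst z)" and y': "y' = snd z + t * (y - snd z)"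
    by (cases z) (auto simp: homothety_def)
  have "((\<lambda>s. u (s, y')) has_real_derivative ux (x', y')) (at x')"
    "((\<lambda>s. u (x', s)) has_real_derivative uy (x', y')) (at y')"
    using assms p'(2) by (auto simp: has_C1_partials_def)
  moreover have "((\<lambda>s. w + t * (s - w)) has_real_derivative t) (at s0)" for w s0
    by (auto intro!: derivative_eq_intros)
  ultimately have "((\<lambda>s. u (fst z + t * (s - fst z), y')) has_real_derivative ux (x', y') * t) (at x)"
    "((\<lambda>s. u (x', snd z + t * (s - snd z))) has_real_derivative uy (x', y') * t) (at y)"
    unfolding x' y' by (auto intro: DERIV_chain2)
  from this[THEN DERIV_cmult, of c]
  show "((\<lambda>s. c * u (homothety z t (s, y))) has_real_derivative
      c * t * ux (homothety z t (x, y))) (at x)"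
    "((\<lambda>s. c * u (homothety z t (x, s))) has_real_derivative
      c * t * uy (homothety z t (x, y))) (at y)"
    unfolding p'(1) by (cases z, simp add: homothety_def x' y' mult_ac)+
next
  have "continuous_on (homothety z t -` U) (\<lambda>p. v (homothety z t p))"
    if "continuous_on U v" for v :: "_ \<Rightarrow> real"
    by (rule continuous_on_compose2[OF that]) (auto intro: continuous_intros)
  then show "continuous_on (homothety z t -` U) (\<lambda>p. c * t * ux (homothety z t p))"
    "continuous_on (homothety z t -` U) (\<lambda>p. c * t * uy (homothety z t p))"
    using assms by (auto simp: has_C1_partials_def intro!: continuous_intros)
qed

lemma C2_on_homothety:
  assumes U: "open U" and u: "C2_on U u"
  shows "C2_on (homothety z t -` U) (\<lambda>p. u (homothety z t p))"
    "\<And>p. homothety z t p \<in> U \<Longrightarrow>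
      laplacian (\<lambda>p. u (homothety z t p)) p = t\<^sup>2 * laplacian u (homothety z t p)"
proof -
  let ?h = "homothety z t"
  have open_preimage: "open (?h -` U)"
    by (intro open_vimage U continuous_intros)
  have partials: "has_C1_partials U u (partial_x u) (partial_y u)"
    "has_C1_partials U (partial_x u) (partial_x (partial_x u)) (partial_y (partial_x u))"
    "has_C1_partials U (partial_y u) (partial_x (partial_y u)) (partial_y (partial_y u))"
    using u by (simp_all add: C2_on_def C1_on_iff_has_C1_partials)
  have "has_C1_partials (?h -` U) (\<lambda>p. u (?h p))
      (\<lambda>p. t * partial_x u (?h p)) (\<lambda>p. t * partial_y u (?h p))"
    using has_C1_partials_homothety[OF partials(1), of z t 1] by simp
  note has_C1_partials_imp_C2_on[OF open_preimage this
      has_C1_partials_homothety[OF partials(2)] has_C1_partials_homothety[OF partials(3)]]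
  then show "C2_on (?h -` U) (\<lambda>p. u (?h p))"
    "\<And>p. ?h p \<in> U \<Longrightarrow> laplacian (\<lambda>p. u (?h p)) p = t\<^sup>2 * laplacian u (?h p)"
    by (simp_all add: laplacian_def power2_eq_square distrib_left)
qed

section \<open>The sine system on an interval\<close>

lemma continuous_eq_0_if_orthogonal_to_approximants:
  fixes g :: "'a::euclidean_space \<Rightarrow> real"
  assumes g: "continuous_on (cbox a b) g" and ne: "box a b \<noteq> {}"
    and approx: "\<And>e. e > 0 \<Longrightarrow> \<exists>h. continuous_on (cbox a b) h \<and>
      (\<forall>x \<in> cbox a b. \<bar>g x - h x\<bar> \<le> e) \<and> integral (cbox a b) (\<lambda>x. g x * h x) = 0"
    and x: "x \<in> cbox a b"
  shows "g x = 0"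
proof -
  define M where "M = integral (cbox a b) (\<lambda>x. \<bar>g x\<bar>)"
  have M: "M \<ge> 0"
    unfolding M_def by (intro integral_nonneg integrable_continuous continuous_intros g) auto
  have small: "integral (cbox a b) (\<lambda>x. (g x)\<^sup>2) \<le> e * M" if "e > 0" for e
  proof -
    obtain h where h: "continuous_on (cbox a b) h" "\<And>x. x \<in> cbox a b \<Longrightarrow> \<bar>g x - h x\<bar> \<le> e"
        "integral (cbox a b) (\<lambda>x. g x * h x) = 0"
      using approx[OF \<open>e > 0\<close>] by blast
    have "integral (cbox a b) (\<lambda>x. (g x)\<^sup>2) = integral (cbox a b) (\<lambda>x. (g x)\<^sup>2 - g x * h x)"
      using h(3)
      by (subst integral_diff) (intro integrable_continuous continuous_intros g h(1) | simp)+
    also have "\<dots> \<le> integral (cbox a b) (\<lambda>x. e * \<bar>g x\<bar>)"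
    proof (rule integral_le)
      fix x assume "x \<in> cbox a b"
      have "(g x)\<^sup>2 - g x * h x = g x * (g x - h x)" by (simp add: power2_eq_square algebra_simps)
      also have "\<dots> \<le> \<bar>g x\<bar> * \<bar>g x - h x\<bar>" by (metis abs_ge_self abs_mult)
      also have "\<dots> \<le> \<bar>g x\<bar> * e" using h(2)[OF \<open>x \<in> cbox a b\<close>] by (intro mult_left_mono) auto
      finally show "(g x)\<^sup>2 - g x * h x \<le> e * \<bar>g x\<bar>" by (simp add: mult.commute)
    qed (intro integrable_continuous continuous_intros g h(1))+
    finally show ?thesis by (simp add: M_def)
  qed
  have "integral (cbox a b) (\<lambda>x. (g x)\<^sup>2) \<le> 0 + e" if "e > 0" for e
  proof -
    have "integral (cbox a b) (\<lambda>x. (g x)\<^sup>2) \<le> e / (M + 1) * M"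
      using that M by (intro small) simp
    also have "\<dots> \<le> e" using that M by (simp add: field_simps)
    finally show ?thesis by simp
  qed
  then have "integral (cbox a b) (\<lambda>x. (g x)\<^sup>2) \<le> 0" by (rule field_le_epsilon)
  moreover have "integral (cbox a b) (\<lambda>x. (g x)\<^sup>2) \<ge> 0"
    by (intro integral_nonneg integrable_continuous continuous_intros g) simp
  ultimately have "\<forall>x \<in> cbox a b. (g x)\<^sup>2 = 0"
    using integral_cbox_eq_0_iff[of a b "\<lambda>x. (g x)\<^sup>2"] ne g by (simp add: continuous_on_power)
  then show ?thesis using x by simp
qed

definition wavenumber :: "real \<Rightarrow> nat \<Rightarrow> real" where
  "wavenumber a m = m * (pi / a)"

lemma wavenumber_mult_side: "a \<noteq> 0 \<Longrightarrow> wavenumber a m * a = m * pi"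
  by (simp add: wavenumber_def)

definition sine_orthogonal :: "real \<Rightarrow> (real \<Rightarrow> real) \<Rightarrow> bool" where
  "sine_orthogonal a f \<longleftrightarrow> continuous_on {0..a} f \<and>
    (\<forall>m>0. integral {0..a} (\<lambda>x. f x * sin (wavenumber a m * x)) = 0)"

lemma sine_orthogonal_cmult: "sine_orthogonal a f \<Longrightarrow> sine_orthogonal a (\<lambda>x. c * f x)"
  by (simp add: sine_orthogonal_def continuous_on_mult_left mult.assoc)

lemma sine_orthogonal_add:
  assumes "sine_orthogonal a f" "sine_orthogonal a g"
  shows "sine_orthogonal a (\<lambda>x. f x + g x)"
proof -
  have "(\<lambda>x. h x * sin (wavenumber a m * x)) integrable_on {0..a}" if "sine_orthogonal a h" for h m
    using that
    by (intro integrable_continuous_interval continuous_intros) (simp add: sine_orthogonal_def)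
  then show ?thesis
    using assms
    by (auto simp: sine_orthogonal_def distrib_right integral_add intro: continuous_intros)
qed

lemma sine_orthogonal_mult_cos:
  assumes f: "sine_orthogonal a f"
  shows "sine_orthogonal a (\<lambda>x. f x * cos (pi / a * x))"
  unfolding sine_orthogonal_def
proof (intro conjI allI impI)
  define h where "h m = (\<lambda>x. f x * sin (wavenumber a m * x))" for m
  have f_cont: "continuous_on {0..a} f" using f by (simp add: sine_orthogonal_def)
  have h_int: "h m integrable_on {0..a}" for m
    unfolding h_def by (intro integrable_continuous_interval continuous_intros f_cont)
  have h_0: "integral {0..a} (h m) = 0" for m
    using f by (cases "m = 0") (auto simp: sine_orthogonal_def h_def wavenumber_def)
  show "continuous_on {0..a} (\<lambda>x. f x * cos (pi / a * x))" by (intro continuous_intros f_cont)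
  fix m :: nat assume "m > 0"
  then obtain j where m: "m = Suc j" by (cases m) auto
  have "f x * cos (pi / a * x) * sin (wavenumber a m * x) = (h (Suc m) x + h j x) / 2" for x
  proof -
    have "wavenumber a m * x + pi / a * x = wavenumber a (Suc m) * x"
      "wavenumber a m * x - pi / a * x = wavenumber a j * x"
      by (simp_all add: m wavenumber_def algebra_simps add_divide_distrib)
    then have "sin (wavenumber a m * x) * cos (pi / a * x) =
        (sin (wavenumber a (Suc m) * x) + sin (wavenumber a j * x)) / 2"
      by (simp add: sin_times_cos)
    then have "f x * (sin (wavenumber a m * x) * cos (pi / a * x)) =
        f x * ((sin (wavenumber a (Suc m) * x) + sin (wavenumber a j * x)) / 2)" by simp
    then show ?thesis by (simp add: h_def distrib_left mult_ac)
  qed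
  then have "integral {0..a} (\<lambda>x. f x * cos (pi / a * x) * sin (wavenumber a m * x)) =
      integral {0..a} (\<lambda>x. (h (Suc m) x + h j x) / 2)" by (rule integral_cong)
  also have "\<dots> = 0" by (simp add: integral_add[OF h_int h_int] h_0)
  finally show "integral {0..a} (\<lambda>x. f x * cos (pi / a * x) * sin (wavenumber a m * x)) = 0" .
qed

lemma sine_orthogonal_mult_polynomial_cos:
  assumes "real_polynomial_function P" "sine_orthogonal a f"
  shows "sine_orthogonal a (\<lambda>x. f x * P (cos (pi / a * x)))"
  using assms
proof (induction arbitrary: f)
  case (linear h)
  then obtain c where h: "h = (\<lambda>u. u * c)" by (auto simp: real_bounded_linear)
  show ?case
    using sine_orthogonal_cmult[OF sine_orthogonal_mult_cos[OF linear(2)], of c]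
    by (simp add: h mult_ac)
next
  case (const c)
  then show ?case using sine_orthogonal_cmult[of a f c] by (simp add: mult.commute)
next
  case (add P Q)
  then show ?case using sine_orthogonal_add by (simp add: distrib_left)
next
  case (mult P Q)
  then show ?case by (simp flip: mult.assoc)
qed

lemma ex_polynomial_cos_approximation:
  assumes a: "a > 0" and g: "continuous_on {0..a} g" and e: "e > 0"
  shows "\<exists>P. real_polynomial_function P \<and> (\<forall>x\<in>{0..a}. \<bar>g x - P (cos (pi / a * x))\<bar> < e)"
proof -
  define w where "w = pi / a"
  have w: "w > 0" using a by (simp add: w_def)
  have "continuous_on {-1..1} (\<lambda>u. g (arccos u / w))"
  proof (rule continuous_on_compose2[OF g])
    show "continuous_on {-1..1} (\<lambda>u. arccos u / w)"
      using w by (intro continuous_intros) auto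
    show "(\<lambda>u. arccos u / w) ` {-1..1} \<subseteq> {0..a}"
      using arccos_lbound arccos_ubound a by (auto simp: w_def field_simps)
  qed
  then obtain P where P: "real_polynomial_function P" "\<And>u. u \<in> {-1..1} \<Longrightarrow> \<bar>g (arccos u / w) - P u\<bar> < e"
    using Stone_Weierstrass_real_polynomial_function[of "{-1..1}" "\<lambda>u. g (arccos u / w)" e] e
    by auto
  have "\<bar>g x - P (cos (w * x))\<bar> < e" if "x \<in> {0..a}" for x
  proof -
    have "w * x \<in> {0..pi}" using that a by (auto simp: w_def field_simps)
    then have "arccos (cos (w * x)) / w = x" using w by (simp add: arccos_cos)
    then show ?thesis using P(2)[of "cos (w * x)"] by simp
  qed
  then show ?thesis using P(1) by (auto simp: w_def)
qed

lemma sine_orthogonal_imp_eq_0: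
  assumes a: "a > 0" and f: "sine_orthogonal a f" and x: "x \<in> {0..a}"
  shows "f x = 0"
proof -
  define w where "w = pi / a"
  have f_cont: "continuous_on {0..a} f" using f by (simp add: sine_orthogonal_def)
  define g where "g x = f x * sin (w * x)" for x
  have g: "continuous_on {0..a} g" unfolding g_def by (intro continuous_intros f_cont)
  have approx: "\<exists>h. continuous_on {0..a} h \<and> (\<forall>x\<in>{0..a}. \<bar>g x - h x\<bar> \<le> e) \<and>
      integral {0..a} (\<lambda>x. g x * h x) = 0" if "e > 0" for e
  proof -
    obtain P where P: "real_polynomial_function P" "\<forall>x\<in>{0..a}. \<bar>g x - P (cos (w * x))\<bar> < e"
      using ex_polynomial_cos_approximation[OF a g \<open>e > 0\<close>] unfolding w_def by blast
    have "continuous_on UNIV P"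
      using P(1) by (simp add: real_polynomial_function_eq continuous_on_polymonial_function)
    then have "continuous_on {0..a} (\<lambda>x. P (cos (w * x)))"
      by (rule continuous_on_compose2[where f = "\<lambda>x. cos (w * x)"]) (auto intro: continuous_intros)
    moreover have "sine_orthogonal a (\<lambda>x. f x * P (cos (w * x)))"
      using sine_orthogonal_mult_polynomial_cos[OF P(1) f] by (simp only: w_def)
    then have "integral {0..a} (\<lambda>x. f x * P (cos (w * x)) * sin (wavenumber a 1 * x)) = 0"
      unfolding sine_orthogonal_def by simp
    then have "integral {0..a} (\<lambda>x. g x * P (cos (w * x))) = 0"
      by (simp add: g_def wavenumber_def w_def mult_ac)
    ultimately show ?thesis using P(2) less_imp_le by blast
  qed
  have "f x = 0" if "x \<in> {0<..<a}" for x
  proof -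
    have "g x = 0"
      using continuous_eq_0_if_orthogonal_to_approximants[of 0 a, unfolded cbox_interval, OF g _ approx]
        that a by simp
    moreover have "sin (w * x) > 0"
      using that a by (intro sin_gt_zero) (auto simp: w_def field_simps)
    ultimately show ?thesis by (simp add: g_def)
  qed
  then show ?thesis
    using continuous_constant_on_closure[of "{0<..<a}" f 0 x] f_cont x a by simp
qed

lemma integral_sine_product:
  assumes a: "a > 0" and "m > 0" "n > 0"
  shows "integral {0..a} (\<lambda>x. sin (wavenumber a m * x) * sin (wavenumber a n * x)) =
    (if m = n then a / 2 else 0)"
proof -
  define w where "w = pi / a"
  have w: "w \<noteq> 0" "w * a = pi" using a by (simp_all add: w_def)
  have cos_int: "((\<lambda>x. cos (of_int j * w * x)) has_integral (if j = 0 then a else 0)) {0..a}" for j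
  proof (cases "j = 0")
    case True
    then show ?thesis using has_integral_const_real[of "1::real" 0 a] a by simp
  next
    case False
    have "((\<lambda>x. cos (of_int j * w * x)) has_integral
       (sin (of_int j * w * a) / (of_int j * w) - sin (of_int j * w * 0) / (of_int j * w))) {0..a}"
      using a w False
      by (intro fundamental_theorem_of_calculus)
        (auto intro!: derivative_eq_intros simp flip: has_real_derivative_iff_has_vector_derivative)
    moreover have "sin (of_int j * w * a) = 0" using w by (simp add: mult.assoc sin_zero_iff_int2)
    ultimately show ?thesis using False by simp
  qed
  have "((\<lambda>x. (cos (of_int (int m - int n) * w * x) - cos (of_int (int m + int n) * w * x)) / 2)
      has_integral ((if int m - int n = 0 then a else 0) -
        (if int m + int n = 0 then a else 0)) / 2) {0..a}"
    by (intro has_integral_divide has_integral_diff cos_int)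
  then have "((\<lambda>x. sin (wavenumber a m * x) * sin (wavenumber a n * x)) has_integral
      (if m = n then a / 2 else 0)) {0..a}"
    using assms by (simp add: sin_times_sin wavenumber_def w_def algebra_simps split: if_splits)
  then show ?thesis by (rule integral_unique)
qed

lemma has_integral_second_derivative_sine:
  fixes w w' w'' :: "real \<Rightarrow> real"
  assumes a: "a > 0"
    and w: "\<And>x. x \<in> {0..a} \<Longrightarrow> (w has_real_derivative w' x) (at x)"
    and w': "\<And>x. x \<in> {0..a} \<Longrightarrow> (w' has_real_derivative w'' x) (at x)"
  shows "((\<lambda>x. (w'' x + (wavenumber a m)\<^sup>2 * w x) * sin (wavenumber a m * x)) has_integral
     wavenumber a m * (w 0 - (-1) ^ m * w a)) {0..a}"
proof -
  define k where "k = wavenumber a m"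
  define F where "F x = w' x * sin (k * x) - k * w x * cos (k * x)" for x
  have "((\<lambda>x. (w'' x + k\<^sup>2 * w x) * sin (k * x)) has_integral (F a - F 0)) {0..a}"
  proof (rule fundamental_theorem_of_calculus)
    fix x assume x: "x \<in> {0..a}"
    have "(F has_real_derivative (w'' x + k\<^sup>2 * w x) * sin (k * x)) (at x)"
      unfolding F_def
      by (rule derivative_eq_intros w[OF x] w'[OF x] refl | simp add: power2_eq_square algebra_simps)+
    then show "(F has_vector_derivative (w'' x + k\<^sup>2 * w x) * sin (k * x)) (at x within {0..a})"
      by (simp add: has_real_derivative_iff_has_vector_derivative has_vector_derivative_at_within)
  qed (use a in simp)
  moreover have "F a - F 0 = k * (w 0 - (-1) ^ m * w a)"
    using a unfolding F_def k_def by (simp add: wavenumber_mult_side right_diff_distrib)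
  ultimately show ?thesis by (simp add: k_def)
qed

lemma has_integral_partial_x_partial_x_sine:
  assumes "a > 0" and W: "C2_on U W" "{0..a} \<times> {y} \<subseteq> U"
  shows "((\<lambda>x. (partial_x (partial_x W) (x, y) + (wavenumber a m)\<^sup>2 * W (x, y)) *
      sin (wavenumber a m * x)) has_integral
    wavenumber a m * (W (0, y) - (-1) ^ m * W (a, y))) {0..a}"
  using W(2) W(1)[unfolded C2_on_def C1_on_iff_has_C1_partials]
  by (intro has_integral_second_derivative_sine[OF \<open>a > 0\<close>, where w' = "\<lambda>x. partial_x W (x, y)"])
    (auto simp: has_C1_partials_def subset_iff)

lemma has_integral_partial_y_partial_y_sine:
  assumes "b > 0" and W: "C2_on U W" "{x} \<times> {0..b} \<subseteq> U"
  shows "((\<lambda>y. (partial_y (partial_y W) (x, y) + (wavenumber b n)\<^sup>2 * W (x, y)) *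
      sin (wavenumber b n * y)) has_integral
    wavenumber b n * (W (x, 0) - (-1) ^ n * W (x, b))) {0..b}"
  using W(2) W(1)[unfolded C2_on_def C1_on_iff_has_C1_partials]
  by (intro has_integral_second_derivative_sine[OF \<open>b > 0\<close>, where w' = "\<lambda>y. partial_y W (x, y)"])
    (auto simp: has_C1_partials_def subset_iff)

section \<open>The sine system on a rectangle\<close>

lemma Times_interval_eq_cbox:
  fixes a b c d :: real
  shows "{a..b} \<times> {c..d} = cbox (a, c) (b, d)"
  by (simp add: cbox_Pair_eq)

lemma integrable_Times_continuous:
  fixes G :: "real \<times> real \<Rightarrow> real"
  assumes "continuous_on ({a..b} \<times> {c..d}) G"
  shows "G integrable_on {a..b} \<times> {c..d}"
  using assms unfolding Times_interval_eq_cbox by (rule integrable_continuous)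

lemma integral_Times_continuous:
  fixes G :: "real \<times> real \<Rightarrow> real"
  assumes G: "continuous_on ({a..b} \<times> {c..d}) G"
  shows "integral ({a..b} \<times> {c..d}) G = integral {a..b} (\<lambda>x. integral {c..d} (\<lambda>y. G (x, y)))"
    and "integral ({a..b} \<times> {c..d}) G = integral {c..d} (\<lambda>y. integral {a..b} (\<lambda>x. G (x, y)))"
  using G integral_prod_continuous[of a c b d G]
    integral_swap_continuous[of a c b d "\<lambda>x y. G (x, y)"]
  unfolding Times_interval_eq_cbox by simp_all

locale rectangle =
  fixes a b :: real
  assumes a_pos: "a > 0" and b_pos: "b > 0"
begin

abbreviation "\<Omega> \<equiv> {0..a} \<times> {0..b}"

lemma interior_rectangle: "interior \<Omega> = {0<..<a} \<times> {0<..<b}"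
  by (simp add: interior_Times)

definition sine_mode :: "nat \<times> nat \<Rightarrow> real \<times> real \<Rightarrow> real" where
  "sine_mode = (\<lambda>(m, n) (x, y). sin (wavenumber a m * x) * sin (wavenumber b n * y))"

lemma continuous_on_sine_mode [continuous_intros]: "continuous_on S (sine_mode i)"
proof -
  have "sine_mode i = (\<lambda>p. sin (wavenumber a (fst i) * fst p) * sin (wavenumber b (snd i) * snd p))"
    by (auto simp: sine_mode_def split: prod.split)
  then show ?thesis by (auto intro!: continuous_intros)
qed

lemma sine_modes_complete:
  assumes f: "continuous_on \<Omega> f"
    and orth: "\<And>i. i \<in> {0<..} \<times> {0<..} \<Longrightarrow> integral \<Omega> (\<lambda>p. f p * sine_mode i p) = 0"
    and p: "p \<in> \<Omega>"
  shows "f p = 0"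
proof -
  define h where "h n x = integral {0..b} (\<lambda>y. f (x, y) * sin (wavenumber b n * y))" for n x
  have h: "sine_orthogonal a (h n)" if "n > 0" for n
    unfolding sine_orthogonal_def
  proof (intro conjI allI impI)
    have "continuous_on \<Omega> (\<lambda>p. f p * sin (wavenumber b n * snd p))"
      by (intro continuous_intros f)
    then show "continuous_on {0..a} (h n)"
      unfolding h_def
      using integral_continuous_on_param[of "{0..a}" 0 b "\<lambda>x y. f (x, y) * sin (wavenumber b n * y)"]
      by (simp add: case_prod_unfold)
    fix m :: nat assume "m > 0"
    have "integral {0..a} (\<lambda>x. h n x * sin (wavenumber a m * x)) =
        integral {0..a} (\<lambda>x. integral {0..b} (\<lambda>y. f (x, y) * sine_mode (m, n) (x, y)))"
      unfolding h_def integral_mult_left[symmetric] by (simp add: sine_mode_def mult_ac)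
    also have "\<dots> = integral \<Omega> (\<lambda>p. f p * sine_mode (m, n) p)"
      by (rule integral_Times_continuous(1)[symmetric]) (intro continuous_intros f)
    finally show "integral {0..a} (\<lambda>x. h n x * sin (wavenumber a m * x)) = 0"
      using orth \<open>m > 0\<close> \<open>n > 0\<close> by simp
  qed
  obtain x y where xy: "p = (x, y)" "x \<in> {0..a}" "y \<in> {0..b}" using p by blast
  have "sine_orthogonal b (\<lambda>y. f (x, y))"
    unfolding sine_orthogonal_def
  proof (intro conjI allI impI)
    show "continuous_on {0..b} (\<lambda>y. f (x, y))"
      using xy by (intro continuous_on_compose2[OF f] continuous_intros) auto
    show "integral {0..b} (\<lambda>y. f (x, y) * sin (wavenumber b n * y)) = 0" if "n > 0" for n
      using sine_orthogonal_imp_eq_0[OF a_pos h[OF that] xy(2)] by (simp add: h_def)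
  qed
  then show ?thesis using sine_orthogonal_imp_eq_0[OF b_pos _ xy(3)] xy(1) by simp
qed

lemma integral_sine_mode_product:
  assumes "i \<in> {0<..} \<times> {0<..}" "j \<in> {0<..} \<times> {0<..}"
  shows "integral \<Omega> (\<lambda>p. sine_mode i p * sine_mode j p) = (if i = j then a * b / 4 else 0)"
proof -
  obtain m n m' n' where ij: "i = (m, n)" "j = (m', n')" by fastforce
  have "integral \<Omega> (\<lambda>p. sine_mode i p * sine_mode j p) =
      integral {0..a} (\<lambda>x. integral {0..b} (\<lambda>y. sine_mode i (x, y) * sine_mode j (x, y)))"
    by (intro integral_Times_continuous(1) continuous_intros)
  also have "\<dots> = integral {0..a} (\<lambda>x. sin (wavenumber a m * x) * sin (wavenumber a m' * x) *
      integral {0..b} (\<lambda>y. sin (wavenumber b n * y) * sin (wavenumber b n' * y)))"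
    unfolding integral_mult_right[symmetric] by (simp add: ij sine_mode_def mult_ac)
  also have "\<dots> = (if m = m' then a / 2 else 0) * (if n = n' then b / 2 else 0)"
    using integral_sine_product[OF a_pos, of m m'] integral_sine_product[OF b_pos, of n n'] assms
    by (simp add: ij)
  finally show ?thesis by (auto simp: ij)
qed

lemma integral_sine_mode_sum_product:
  assumes "finite S" "S \<subseteq> {0<..} \<times> {0<..}" "j \<in> {0<..} \<times> {0<..}"
  shows "integral \<Omega> (\<lambda>p. (\<Sum>i\<in>S. c i * sine_mode i p) * sine_mode j p) =
    (if j \<in> S then c j * (a * b / 4) else 0)"
proof -
  have "integral \<Omega> (\<lambda>p. (\<Sum>i\<in>S. c i * sine_mode i p) * sine_mode j p) =
      integral \<Omega> (\<lambda>p. \<Sum>i\<in>S. c i * (sine_mode i p * sine_mode j p))"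
    by (simp add: sum_distrib_right mult.assoc)
  also have "\<dots> = (\<Sum>i\<in>S. c i * integral \<Omega> (\<lambda>p. sine_mode i p * sine_mode j p))"
    using assms(1)
    by (subst integral_sum) (auto intro!: integrable_Times_continuous continuous_intros)
  also have "\<dots> = (\<Sum>i\<in>S. if i = j then c j * (a * b / 4) else 0)"
    by (intro sum.cong refl) (simp add: integral_sine_mode_product subsetD[OF assms(2)] assms(3))
  also have "\<dots> = (if j \<in> S then c j * (a * b / 4) else 0)" using assms(1) by simp
  finally show ?thesis .
qed

section \<open>Green's identity\<close>

definition mode_eigenvalue :: "nat \<times> nat \<Rightarrow> real" where
  "mode_eigenvalue = (\<lambda>(m, n). (wavenumber a m)\<^sup>2 + (wavenumber b n)\<^sup>2)"

text \<open>The boundary integral of \<open>- W \<partial>\<^sub>\<nu> s\<close> for the sine mode \<open>s\<close>.\<close>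

definition sine_flux :: "nat \<times> nat \<Rightarrow> (real \<times> real \<Rightarrow> real) \<Rightarrow> real" where
  "sine_flux = (\<lambda>(m, n) W.
     integral {0..b} (\<lambda>y.
       wavenumber a m * (W (0, y) - (-1) ^ m * W (a, y)) * sin (wavenumber b n * y)) +
     integral {0..a} (\<lambda>x.
       wavenumber b n * (W (x, 0) - (-1) ^ n * W (x, b)) * sin (wavenumber a m * x)))"

lemma green_sine_mode:
  assumes W: "C2_on U W" "\<Omega> \<subseteq> U" "continuous_on \<Omega> W"
  shows "integral \<Omega> (\<lambda>p. (laplacian W p + mode_eigenvalue i * W p) * sine_mode i p) = sine_flux i W"
proof -
  obtain m n where i: "i = (m, n)" by fastforce
  define k l where "k = wavenumber a m" and "l = wavenumber b n"
  let ?Wxx = "partial_x (partial_x W)" and ?Wyy = "partial_y (partial_y W)"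
  define Gx where "Gx p = (?Wxx p + k\<^sup>2 * W p) * sin (k * fst p) * sin (l * snd p)" for p
  define Gy where "Gy p = (?Wyy p + l\<^sup>2 * W p) * sin (l * snd p) * sin (k * fst p)" for p
  have "continuous_on \<Omega> ?Wxx" "continuous_on \<Omega> ?Wyy"
    using W(1,2) by (auto simp: C2_on_def C1_on_def intro: continuous_on_subset)
  then have G: "continuous_on \<Omega> Gx" "continuous_on \<Omega> Gy"
    unfolding Gx_def Gy_def by (auto intro!: continuous_intros W(3))
  have "integral {0..a} (\<lambda>x. Gx (x, y)) = k * (W (0, y) - (-1) ^ m * W (a, y)) * sin (l * y)"
    if "y \<in> {0..b}" for y
    unfolding Gx_def fst_conv snd_conv k_def using W(1,2) that
    by (intro integral_unique has_integral_mult_left has_integral_partial_x_partial_x_sine a_pos) auto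
  then have "integral \<Omega> Gx = integral {0..b} (\<lambda>y. k * (W (0, y) - (-1) ^ m * W (a, y)) * sin (l * y))"
    unfolding integral_Times_continuous(2)[OF G(1)] by (rule integral_cong)
  moreover have "integral {0..b} (\<lambda>y. Gy (x, y)) = l * (W (x, 0) - (-1) ^ n * W (x, b)) * sin (k * x)"
    if "x \<in> {0..a}" for x
    unfolding Gy_def fst_conv snd_conv l_def using W(1,2) that
    by (intro integral_unique has_integral_mult_left has_integral_partial_y_partial_y_sine b_pos) auto
  then have "integral \<Omega> Gy = integral {0..a} (\<lambda>x. l * (W (x, 0) - (-1) ^ n * W (x, b)) * sin (k * x))"
    unfolding integral_Times_continuous(1)[OF G(2)] by (rule integral_cong)
  moreover have "(laplacian W p + mode_eigenvalue i * W p) * sine_mode i p = Gx p + Gy p" for p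
    by (cases p)
      (simp add: i laplacian_def mode_eigenvalue_def sine_mode_def
        Gx_def Gy_def k_def l_def algebra_simps)
  ultimately show ?thesis
    by (simp add: integral_add integrable_Times_continuous G sine_flux_def i k_def l_def)
qed

lemma continuous_on_integral_sine_mode:
  assumes "continuous_on (T \<times> \<Omega>) (\<lambda>(t, p). W t p)"
  shows "continuous_on T (\<lambda>t. integral \<Omega> (\<lambda>p. W t p * sine_mode i p))"
proof -
  have "continuous_on (T \<times> \<Omega>) (\<lambda>(t, p). W t p * sine_mode i p)"
    unfolding case_prod_unfold using assms
    by (intro continuous_intros continuous_on_compose2[OF continuous_on_sine_mode[of UNIV]])
      (auto simp: case_prod_unfold)
  then show ?thesis
    unfolding Times_interval_eq_cbox by (rule integral_continuous_on_param)
qed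

lemma continuous_on_sine_flux:
  fixes T :: "real set"
  assumes W: "continuous_on (T \<times> \<Omega>) (\<lambda>(t, p). W t p)"
  shows "continuous_on T (\<lambda>t. sine_flux i (W t))"
proof -
  have W_comp: "continuous_on (T \<times> S) (\<lambda>z. W (fst z) (g (snd z)))"
    if "continuous_on S g" "g ` S \<subseteq> \<Omega>" for g and S :: "real set"
  proof -
    have "continuous_on (T \<times> S) (\<lambda>z. (fst z, g (snd z)))"
      by (intro continuous_intros continuous_on_compose2[OF that(1)]) auto
    from continuous_on_compose2[OF W this] show ?thesis using that(2) by fastforce
  qed
  have param: "continuous_on T (\<lambda>t. integral {u..v} (G t))"
    if "continuous_on (T \<times> {u..v}) (\<lambda>z. G (fst z) (snd z))" for G :: "real \<Rightarrow> real \<Rightarrow> real" and u v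
    using integral_continuous_on_param[of T u v G] that by (simp add: case_prod_unfold)
  show ?thesis
    unfolding sine_flux_def case_prod_unfold using a_pos b_pos
    by (intro continuous_intros param W_comp) auto
qed

end

section \<open>Eigenspaces of the rectangle\<close>

interpretation fun_space: vector_space "fun_scale :: real \<Rightarrow> ('a \<Rightarrow> real) \<Rightarrow> 'a \<Rightarrow> real"
  by (rule vector_space_fun_scale)

lemma sum_fun_apply: "(\<Sum>i\<in>A. f i) x = (\<Sum>i\<in>A. f i x)"
  by (induction A rule: infinite_finite_induct) auto

lemma (in vector_space) dim_eq_card_family:
  assumes S: "finite S" and V: "f ` S \<subseteq> V" "V \<subseteq> span (f ` S)"
    and indep: "\<And>c i. (\<Sum>i\<in>S. scale (c i) (f i)) = 0 \<Longrightarrow> i \<in> S \<Longrightarrow> c i = 0"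
  shows "dim V = card S"
proof (rule dim_unique[OF V])
  have inj: "inj_on f S"
  proof (rule inj_onI, rule ccontr)
    fix i j assume ij: "i \<in> S" "j \<in> S" "f i = f j" "i \<noteq> j"
    define c :: "_ \<Rightarrow> 'a" where "c k = (if k = i then 1 else if k = j then - 1 else 0)" for k
    have "(\<Sum>k\<in>S. scale (c k) (f k)) = (\<Sum>k\<in>{i, j}. scale (c k) (f k))"
      using S ij by (intro sum.mono_neutral_right) (auto simp: c_def)
    also have "\<dots> = 0" using ij by (simp add: c_def)
    finally show False using indep[of c i] ij by (simp add: c_def)
  qed
  then show "card (f ` S) = card S" by (rule card_image)
  show "independent (f ` S)"
  proof (rule independent_if_scalars_zero)
    fix g x assume "(\<Sum>x\<in>f ` S. scale (g x) x) = 0" "x \<in> f ` S"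
    then show "g x = 0" using indep[of "g \<circ> f"] inj by (auto simp: sum.reindex)
  qed (use S in simp)
qed

context rectangle
begin

lemma dirichlet_eigenspace_rectangle_iff:
  "V \<in> dirichlet_eigenspace \<Omega> \<mu> \<longleftrightarrow> continuous_on \<Omega> V \<and> C2_on (interior \<Omega>) V \<and>
    (\<forall>p \<in> interior \<Omega>. - laplacian V p = \<mu> * V p) \<and> (\<forall>p. p \<notin> interior \<Omega> \<longrightarrow> V p = 0)"
proof -
  have "closed \<Omega>" by (intro closed_Times closed_atLeastAtMost)
  then have closure: "closure \<Omega> = \<Omega>" by (rule closure_closed)
  then have "(\<forall>p. p \<notin> interior \<Omega> \<longrightarrow> V p = 0) \<longleftrightarrow>
      (\<forall>p \<in> frontier \<Omega>. V p = 0) \<and> (\<forall>p. p \<notin> closure \<Omega> \<longrightarrow> V p = 0)"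
    using interior_subset[of \<Omega>] unfolding frontier_def by blast
  then show ?thesis by (simp only: dirichlet_eigenspace_def mem_Collect_eq closure)
qed

lemma green_contracted_eigenfunction:
  assumes V: "V \<in> dirichlet_eigenspace \<Omega> \<mu>" and z: "z \<in> interior \<Omega>" and t: "0 \<le> t" "t < 1"
  shows "(mode_eigenvalue i - \<mu> * t\<^sup>2) * integral \<Omega> (\<lambda>p. V (homothety z t p) * sine_mode i p) =
    sine_flux i (\<lambda>p. V (homothety z t p))"
proof -
  let ?h = "homothety z t" and ?W = "\<lambda>p. V (homothety z t p)"
  have C2: "C2_on (interior \<Omega>) V" and eq: "\<And>p. p \<in> interior \<Omega> \<Longrightarrow> laplacian V p = - \<mu> * V p"
    and cont: "continuous_on \<Omega> V"
    using V by (auto simp: dirichlet_eigenspace_rectangle_iff minus_equation_iff)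
  have h: "?h p \<in> interior \<Omega>" if "p \<in> \<Omega>" for p
    using homothety_mem_interior[OF _ z that t] by (simp add: convex_Times)
  then have "\<Omega> \<subseteq> ?h -` interior \<Omega>" by blast
  moreover have "continuous_on \<Omega> ?W"
    using h interior_subset by (intro continuous_on_compose2[OF cont] continuous_intros) blast
  ultimately have "integral \<Omega> (\<lambda>p. (laplacian ?W p + mode_eigenvalue i * ?W p) * sine_mode i p) =
      sine_flux i ?W"
    by (rule green_sine_mode[OF C2_on_homothety(1)[OF open_interior C2]])
  moreover have "laplacian ?W p = - \<mu> * t\<^sup>2 * ?W p" if "p \<in> \<Omega>" for p
    using C2_on_homothety(2)[OF open_interior C2 h[OF that]] eq[OF h[OF that]] by simp
  then have "integral \<Omega> (\<lambda>p. (laplacian ?W p + mode_eigenvalue i * ?W p) * sine_mode i p) =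
      integral \<Omega> (\<lambda>p. (mode_eigenvalue i - \<mu> * t\<^sup>2) * (?W p * sine_mode i p))"
    by (intro integral_cong) (simp add: algebra_simps)
  ultimately show ?thesis by simp
qed

text \<open>Nothing is known about the derivatives of \<open>V\<close> near the boundary, so Green's identity is
  applied to a contraction of \<open>V\<close>, whose derivatives are continuous on the closed rectangle, and
  the contraction factor tends to 1.\<close>

lemma eigenfunction_orthogonal_sine_mode:
  assumes V: "V \<in> dirichlet_eigenspace \<Omega> \<mu>" and ne: "mode_eigenvalue i \<noteq> \<mu>"
  shows "integral \<Omega> (\<lambda>p. V p * sine_mode i p) = 0"
proof -
  define z where "z = (a / 2, b / 2)"
  have z: "z \<in> interior \<Omega>" using a_pos b_pos by (simp add: z_def interior_rectangle)
  define W where "W t = (\<lambda>p. V (homothety z t p))" for t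
  define \<Phi> where "\<Phi> t = (mode_eigenvalue i - \<mu> * t\<^sup>2) * integral \<Omega> (\<lambda>p. W t p * sine_mode i p) -
    sine_flux i (W t)" for t
  have cont: "continuous_on \<Omega> V" and boundary: "\<And>p. p \<notin> interior \<Omega> \<Longrightarrow> V p = 0"
    using V by (auto simp: dirichlet_eigenspace_rectangle_iff)
  have "homothety z t p \<in> \<Omega>" if "t \<in> {0..1}" "p \<in> \<Omega>" for t p
    using z interior_subset that
    by (intro homothety_mem_convex convex_Times convex_closed_interval) auto
  then have "(\<lambda>x. homothety z (fst x) (snd x)) ` ({0..1} \<times> \<Omega>) \<subseteq> \<Omega>"
    by (intro image_subsetI) (simp only: mem_Times_iff)
  then have "continuous_on ({0..1} \<times> \<Omega>) (\<lambda>(t, p). W t p)"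
    unfolding W_def case_prod_unfold by (intro continuous_on_compose2[OF cont] continuous_intros)
  then have "continuous_on {0..1} \<Phi>"
    unfolding \<Phi>_def
    by (intro continuous_intros continuous_on_integral_sine_mode continuous_on_sine_flux)
  moreover have "\<Phi> t = 0" if "t \<in> {0<..<1}" for t
    using green_contracted_eigenfunction[OF V z, of t] that by (simp add: \<Phi>_def W_def)
  ultimately have "\<Phi> 1 = 0"
    using continuous_constant_on_closure[of "{0<..<1}" \<Phi> 0 1] by simp
  moreover have "W 1 = V" by (simp add: W_def)
  moreover have "sine_flux i V = 0"
    using boundary by (simp add: sine_flux_def interior_rectangle case_prod_unfold)
  ultimately show ?thesis using ne by (simp add: \<Phi>_def)
qed

definition dirichlet_mode :: "nat \<times> nat \<Rightarrow> real \<times> real \<Rightarrow> real" where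
  "dirichlet_mode i p = (if p \<in> \<Omega> then sine_mode i p else 0)"

lemma dirichlet_mode_outside_interior:
  assumes "p \<notin> interior \<Omega>"
  shows "dirichlet_mode i p = 0"
proof (cases "p \<in> \<Omega>")
  case True
  then have "fst p \<in> {0, a} \<or> snd p \<in> {0, b}"
    using assms by (cases p) (auto simp: interior_rectangle)
  then have "sine_mode i p = 0"
    using a_pos b_pos by (cases i; cases p) (auto simp: sine_mode_def wavenumber_mult_side)
  then show ?thesis by (simp add: dirichlet_mode_def)
next
  case False
  then show ?thesis unfolding dirichlet_mode_def by (rule if_not_P)
qed

lemma dirichlet_mode_in_eigenspace:
  "dirichlet_mode i \<in> dirichlet_eigenspace \<Omega> (mode_eigenvalue i)"
proof -
  obtain m n where i: "i = (m, n)" by fastforce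
  define k l where "k = wavenumber a m" and "l = wavenumber b n"
  have in_rect: "p \<in> \<Omega>" if "p \<in> interior \<Omega>" for p
    using that interior_subset by blast
  have mode: "dirichlet_mode i p = sin (k * fst p) * sin (l * snd p)" if "p \<in> \<Omega>" for p
    using that by (cases p) (simp add: dirichlet_mode_def sine_mode_def i k_def l_def)
  have "has_C1_partials (interior \<Omega>) (\<lambda>p. sin (k * fst p) * sin (l * snd p))
      (\<lambda>p. k * (cos (k * fst p) * sin (l * snd p))) (\<lambda>p. l * (sin (k * fst p) * cos (l * snd p)))"
    by (auto simp: has_C1_partials_def intro!: derivative_eq_intros continuous_intros)
  then have mode_partials: "has_C1_partials (interior \<Omega>) (dirichlet_mode i)
      (\<lambda>p. k * (cos (k * fst p) * sin (l * snd p))) (\<lambda>p. l * (sin (k * fst p) * cos (l * snd p)))"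
    by (rule has_C1_partials_cong[OF open_interior]) (simp_all only: mode[OF in_rect])
  have x_partials: "has_C1_partials (interior \<Omega>) (\<lambda>p. k * (cos (k * fst p) * sin (l * snd p)))
      (\<lambda>p. - k\<^sup>2 * (sin (k * fst p) * sin (l * snd p)))
      (\<lambda>p. k * l * (cos (k * fst p) * cos (l * snd p)))"
    by (auto simp: has_C1_partials_def power2_eq_square
        intro!: derivative_eq_intros continuous_intros)
  have y_partials: "has_C1_partials (interior \<Omega>) (\<lambda>p. l * (sin (k * fst p) * cos (l * snd p)))
      (\<lambda>p. k * l * (cos (k * fst p) * cos (l * snd p)))
      (\<lambda>p. - l\<^sup>2 * (sin (k * fst p) * sin (l * snd p)))"
    by (auto simp: has_C1_partials_def power2_eq_square
        intro!: derivative_eq_intros continuous_intros)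
  note C2 = has_C1_partials_imp_C2_on[OF open_interior mode_partials x_partials y_partials]
  have "continuous_on \<Omega> (dirichlet_mode i)"
    using continuous_on_sine_mode by (rule continuous_on_eq) (simp add: dirichlet_mode_def)
  moreover have "- laplacian (dirichlet_mode i) p = mode_eigenvalue i * dirichlet_mode i p"
    if "p \<in> interior \<Omega>" for p
    unfolding C2(2)[OF that] mode[OF in_rect[OF that]]
    by (simp add: mode_eigenvalue_def i k_def l_def distrib_right)
  ultimately show ?thesis using C2(1) dirichlet_mode_outside_interior
    by (simp only: dirichlet_eigenspace_rectangle_iff) blast
qed

definition eigenmodes :: "real \<Rightarrow> (nat \<times> nat) set" where
  "eigenmodes \<mu> = {i \<in> {0<..} \<times> {0<..}. mode_eigenvalue i = \<mu>}"

lemma finite_eigenmodes: "finite (eigenmodes \<mu>)"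
proof (rule finite_subset)
  have bound: "m \<le> nat \<lceil>\<mu> / (pi / c)\<^sup>2\<rceil>" if "(wavenumber c m)\<^sup>2 \<le> \<mu>" "c > 0" for m c
  proof -
    have "real m \<le> (real m)\<^sup>2" by (cases m) (simp_all add: power2_eq_square)
    also have "\<dots> \<le> \<mu> / (pi / c)\<^sup>2"
      using that by (simp add: wavenumber_def pos_le_divide_eq flip: power_mult_distrib)
    finally show ?thesis by linarith
  qed
  have "(wavenumber a m)\<^sup>2 \<le> \<mu>" "(wavenumber b n)\<^sup>2 \<le> \<mu>" if "(m, n) \<in> eigenmodes \<mu>" for m n
    using that by (auto simp: eigenmodes_def mode_eigenvalue_def)
  then show "eigenmodes \<mu> \<subseteq> {..nat \<lceil>\<mu> / (pi / a)\<^sup>2\<rceil>} \<times> {..nat \<lceil>\<mu> / (pi / b)\<^sup>2\<rceil>}"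
    using bound a_pos b_pos by auto
qed simp

lemma eigenmodes_independent:
  assumes sum: "(\<Sum>i\<in>eigenmodes \<mu>. fun_scale (c i) (dirichlet_mode i)) = 0" and j: "j \<in> eigenmodes \<mu>"
  shows "c j = 0"
proof -
  have "(\<Sum>i\<in>eigenmodes \<mu>. c i * sine_mode i p) = 0" if "p \<in> \<Omega>" for p
    using fun_cong[OF sum, of p] that by (simp add: sum_fun_apply fun_scale_def dirichlet_mode_def)
  then have "integral \<Omega> (\<lambda>p. (\<Sum>i\<in>eigenmodes \<mu>. c i * sine_mode i p) * sine_mode j p) =
      integral \<Omega> (\<lambda>p. 0)"
    by (intro integral_cong) simp
  then show ?thesis
    using integral_sine_mode_sum_product[OF finite_eigenmodes, of \<mu> j c] j a_pos b_pos
    by (auto simp: eigenmodes_def)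
qed

lemma eigenfunction_eq_sum_modes:
  assumes V: "V \<in> dirichlet_eigenspace \<Omega> \<mu>"
  obtains c where "V = (\<Sum>i\<in>eigenmodes \<mu>. fun_scale (c i) (dirichlet_mode i))"
proof
  have V_cont: "continuous_on \<Omega> V" and V_out: "\<And>p. p \<notin> \<Omega> \<Longrightarrow> V p = 0"
    using V interior_subset[of \<Omega>] by (auto simp only: dirichlet_eigenspace_rectangle_iff)
  define c where "c i = integral \<Omega> (\<lambda>p. V p * sine_mode i p) / (a * b / 4)" for i
  define U where "U p = (\<Sum>i\<in>eigenmodes \<mu>. c i * sine_mode i p)" for p
  have U_cont: "continuous_on \<Omega> U" unfolding U_def by (intro continuous_intros)
  have "V p - U p = 0" if "p \<in> \<Omega>" for p
  proof (rule sine_modes_complete[OF _ _ that])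
    show "continuous_on \<Omega> (\<lambda>p. V p - U p)" by (intro continuous_intros V_cont U_cont)
    fix j :: "nat \<times> nat" assume j: "j \<in> {0<..} \<times> {0<..}"
    have "integral \<Omega> (\<lambda>p. U p * sine_mode j p) = (if j \<in> eigenmodes \<mu> then c j * (a * b / 4) else 0)"
      unfolding U_def
      by (rule integral_sine_mode_sum_product[OF finite_eigenmodes _ j]) (auto simp: eigenmodes_def)
    also have "\<dots> = integral \<Omega> (\<lambda>p. V p * sine_mode j p)"
      using eigenfunction_orthogonal_sine_mode[OF V, of j] j a_pos b_pos
      by (auto simp: c_def eigenmodes_def)
    finally show "integral \<Omega> (\<lambda>p. (V p - U p) * sine_mode j p) = 0"
      using V_cont U_cont
      by (simp add: left_diff_distrib integral_diff integrable_Times_continuous continuous_intros)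
  qed
  then have "V p = (\<Sum>i\<in>eigenmodes \<mu>. c i * dirichlet_mode i p)" for p
    using V_out[of p] by (cases "p \<in> \<Omega>") (simp_all only: U_def dirichlet_mode_def, simp_all)
  then show "V = (\<Sum>i\<in>eigenmodes \<mu>. fun_scale (c i) (dirichlet_mode i))"
    by (simp add: fun_eq_iff sum_fun_apply fun_scale_def)
qed

lemma eigenvalue_multiplicity_rectangle: "eigenvalue_multiplicity \<Omega> \<mu> = card (eigenmodes \<mu>)"
  unfolding eigenvalue_multiplicity_def
proof (rule fun_space.dim_eq_card_family[OF finite_eigenmodes])
  show "dirichlet_mode ` eigenmodes \<mu> \<subseteq> dirichlet_eigenspace \<Omega> \<mu>"
    using dirichlet_mode_in_eigenspace by (auto simp: eigenmodes_def)
  show "dirichlet_eigenspace \<Omega> \<mu> \<subseteq> fun_space.span (dirichlet_mode ` eigenmodes \<mu>)"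
  proof
    fix V assume "V \<in> dirichlet_eigenspace \<Omega> \<mu>"
    then obtain c where "V = (\<Sum>i\<in>eigenmodes \<mu>. fun_scale (c i) (dirichlet_mode i))"
      by (rule eigenfunction_eq_sum_modes)
    then show "V \<in> fun_space.span (dirichlet_mode ` eigenmodes \<mu>)"
      by (simp add: fun_space.span_sum fun_space.span_scale fun_space.span_base)
  qed
qed (rule eigenmodes_independent)

lemma dirichlet_eigenvalue_rectangle_iff: "dirichlet_eigenvalue \<Omega> \<mu> \<longleftrightarrow> eigenmodes \<mu> \<noteq> {}"
proof
  assume "dirichlet_eigenvalue \<Omega> \<mu>"
  then obtain V p where "V \<in> dirichlet_eigenspace \<Omega> \<mu>" "V p \<noteq> 0"
    by (auto simp: dirichlet_eigenvalue_def)
  then show "eigenmodes \<mu> \<noteq> {}" by (auto elim!: eigenfunction_eq_sum_modes)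
next
  assume "eigenmodes \<mu> \<noteq> {}"
  then obtain i where i: "i \<in> eigenmodes \<mu>" by blast
  have "dirichlet_mode i \<noteq> 0"
  proof
    assume "dirichlet_mode i = 0"
    then have "(\<Sum>j\<in>eigenmodes \<mu>. fun_scale (if j = i then 1 else 0) (dirichlet_mode j)) = 0"
      by (intro sum.neutral) (auto simp: fun_scale_def zero_fun_def)
    from eigenmodes_independent[OF this i] show False by simp
  qed
  then have "\<exists>p. dirichlet_mode i p \<noteq> 0" by (auto simp: fun_eq_iff)
  then show "dirichlet_eigenvalue \<Omega> \<mu>"
    using dirichlet_mode_in_eigenspace[of i] i
    by (auto simp: dirichlet_eigenvalue_def eigenmodes_def)
qed

lemma property_M_rectangle_iff: "property_M \<Omega> \<longleftrightarrow> (\<forall>k\<ge>1. \<exists>\<mu>. card (eigenmodes \<mu>) = k)"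
proof -
  have "{eigenvalue_multiplicity \<Omega> \<mu> |\<mu>. dirichlet_eigenvalue \<Omega> \<mu>} =
      range (\<lambda>\<mu>. card (eigenmodes \<mu>)) \<inter> {1..}"
    using finite_eigenmodes
    by (auto simp: eigenvalue_multiplicity_rectangle
        dirichlet_eigenvalue_rectangle_iff Suc_le_eq card_gt_0_iff)
  then show ?thesis unfolding property_M_def by (auto simp: set_eq_iff image_iff) metis
qed

lemma card_eigenmodes_le_1:
  assumes irrational: "(a / b)\<^sup>2 \<notin> \<rat>"
  shows "card (eigenmodes \<mu>) \<le> 1"
proof -
  have "i = j" if "i \<in> eigenmodes \<mu>" "j \<in> eigenmodes \<mu>" for i j
  proof -
    obtain m n m' n' where ij: "i = (m, n)" "j = (m', n')" by fastforce
    define M where "M = (real m)\<^sup>2 - (real m')\<^sup>2"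
    define N where "N = (real n')\<^sup>2 - (real n)\<^sup>2"
    have "(m * (pi / a))\<^sup>2 + (n * (pi / b))\<^sup>2 = (m' * (pi / a))\<^sup>2 + (n' * (pi / b))\<^sup>2"
      using that by (simp add: eigenmodes_def mode_eigenvalue_def wavenumber_def ij)
    then have "pi\<^sup>2 * (M / a\<^sup>2) = pi\<^sup>2 * (N / b\<^sup>2)"
      by (simp add: M_def N_def power_mult_distrib power_divide algebra_simps diff_divide_distrib)
    then have MN: "M = N * (a / b)\<^sup>2" using a_pos b_pos by (simp add: field_simps power_divide)
    have "N = 0"
    proof (rule ccontr)
      assume "N \<noteq> 0"
      then have "(a / b)\<^sup>2 = M / N" using MN by (simp add: field_simps)
      moreover have "M / N \<in> \<rat>"
        unfolding M_def N_def by (intro Rats_divide Rats_diff Rats_power Rats_of_nat)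
      ultimately show False using irrational by simp
    qed
    then have "M = 0" using MN by simp
    with \<open>N = 0\<close> show "i = j" by (simp add: M_def N_def ij)
  qed
  then show ?thesis using card_le_Suc0_iff_eq[OF finite_eigenmodes] by simp
qed

lemma card_eigenmodes_eq_card_representations:
  fixes p q N :: int
  assumes pq: "0 < p" "0 < q" "(a / b)\<^sup>2 = p / q"
  shows "card (eigenmodes (pi\<^sup>2 / (q * a\<^sup>2) * N)) = card (representations q p N)"
proof -
  define \<kappa> where "\<kappa> = pi\<^sup>2 / (q * a\<^sup>2)"
  have b_square: "b\<^sup>2 = a\<^sup>2 * q / p" using pq a_pos b_pos by (simp add: field_simps power_divide)
  have "mode_eigenvalue (m, n) = \<kappa> * of_int (q * (int m)\<^sup>2 + p * (int n)\<^sup>2)" for m n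
    using a_pos pq(1,2)
    by (simp add: \<kappa>_def mode_eigenvalue_def wavenumber_def
        power_mult_distrib power_divide b_square field_simps)
  then have "mode_eigenvalue (m, n) = \<kappa> * N \<longleftrightarrow> q * (int m)\<^sup>2 + p * (int n)\<^sup>2 = N" for m n
    using a_pos pq by (simp add: \<kappa>_def del: of_int_add of_int_mult)
  then have mem: "(m, n) \<in> eigenmodes (\<kappa> * N) \<longleftrightarrow> (int m, int n) \<in> representations q p N" for m n
    by (simp add: eigenmodes_def representations_def)
  have "bij_betw (map_prod int int) (eigenmodes (\<kappa> * N)) (representations q p N)"
  proof (rule bij_betwI')
    fix z assume z: "z \<in> representations q p N"
    then obtain m n where "z = (int m, int n)"
      by (cases z) (auto simp: representations_def dest!: zero_less_imp_eq_int)
    then show "\<exists>i \<in> eigenmodes (\<kappa> * N). z = map_prod int int i"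
      using z mem by (intro bexI[of _ "(m, n)"]) auto
  qed (auto simp: mem)
  then show ?thesis by (simp add: \<kappa>_def bij_betw_same_card)
qed

end

theorem theorem1p1:
  fixes a b :: real
  assumes "a > 0" and "b > 0"
  shows "property_M ({0..a} \<times> {0..b}) \<longleftrightarrow> (a / b)\<^sup>2 \<in> \<rat>"
proof -
  interpret rectangle a b using assms by unfold_locales
  show ?thesis
  proof
    assume "property_M ({0..a} \<times> {0..b})"
    then obtain \<mu> where "card (eigenmodes \<mu>) = 2"
      using property_M_rectangle_iff one_le_numeral by metis
    then show "(a / b)\<^sup>2 \<in> \<rat>" using card_eigenmodes_le_1[of \<mu>] by linarith
  next
    assume "(a / b)\<^sup>2 \<in> \<rat>"
    then obtain p q :: int where pq: "0 < q" "(a / b)\<^sup>2 = p / q" by (rule Rats_cases')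
    have "p / q > 0" using assms by (simp flip: pq(2))
    then have "0 < p" using pq(1) by (simp add: zero_less_divide_iff)
    then show "property_M ({0..a} \<times> {0..b})"
      unfolding property_M_rectangle_iff
      using card_eigenmodes_eq_card_representations[OF _ pq] ex_card_representations_eq[OF pq(1)]
      by metis
  qed
qed

end
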